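(* Let $\mathbb{K}$ be an algebraically closed field of characteristic zero, let $X$ be a rigid affine variety over $\mathbb{K}$, let $\mathbb{T}$ be the unique maximal torus of $\mathrm{Aut}(X)$, let $r=\dim\mathbb{T}$, and let $C$ be the centralizer of $\mathbb{T}$ in $\mathrm{Aut}(X)$. Then $C$ is a normal subgroup of $\mathrm{Aut}(X)$ and the factor group $\mathrm{Aut}(X)/C$ is isomorphic to a subgroup of $\mathrm{GL}_r(\mathbb{Z})$.
   Context: $\mathrm{Aut}(X)$ is the (abstract) group of all algebraic automorphisms of the variety $X$. A subgroup $G\subseteq\mathrm{Aut}(X)$ is called algebraic if $G$ admits a structure of an algebraic group such that the action $G\times X\to X$ is a morphism. A subtorus is an algebraic subgroup isomorphic to a direct product of finitely many copies of $\mathbb{K}^{\times}$. An irreducible affine variety $X$ is called rigid if it admits no nontrivial regular action of the additive group $\mathbb{G}_a=(\mathbb{K},+)$. For a rigid affine variety $X$ there is a (unique) subtorus $\mathbb{T}$ of $\mathrm{Aut}(X)$ containing all other subtori; it is called the maximal torus of $\mathrm{Aut}(X)$. *)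

theory Defs
  imports
    "HOL-Algebra.Group_Action"
    "HOL-Computational_Algebra.Polynomial"
    "HOL-Library.Extended_Nat"
    "Jordan_Normal_Form.Matrix"
begin

section \<open>Affine varieties\<close>

text \<open>
  Affine n-space over the ground field is \<^term>\<open>carrier_vec n\<close>. The ground field will be
  infinite, so polynomials and polynomial functions are the same thing.
\<close>

inductive_set poly_funs :: "nat \<Rightarrow> ('k::comm_ring_1 vec \<Rightarrow> 'k) set" for n :: nat where
  const: "(\<lambda>_. c) \<in> poly_funs n"
| coord: "i < n \<Longrightarrow> (\<lambda>x. x $ i) \<in> poly_funs n"
| add: "p \<in> poly_funs n \<Longrightarrow> q \<in> poly_funs n \<Longrightarrow> (\<lambda>x. p x + q x) \<in> poly_funs n"
| mult: "p \<in> poly_funs n \<Longrightarrow> q \<in> poly_funs n \<Longrightarrow> (\<lambda>x. p x * q x) \<in> poly_funs n"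

definition zariski_closed :: "nat \<Rightarrow> 'k::comm_ring_1 vec set \<Rightarrow> bool" where
  "zariski_closed n V \<longleftrightarrow>
     (\<exists>F \<subseteq> poly_funs n. V = {x \<in> carrier_vec n. \<forall>f\<in>F. f x = 0})"

definition irreducible_closed :: "nat \<Rightarrow> 'k::comm_ring_1 vec set \<Rightarrow> bool" where
  "irreducible_closed n V \<longleftrightarrow> zariski_closed n V \<and> V \<noteq> {} \<and>
     (\<forall>A B. zariski_closed n A \<longrightarrow> zariski_closed n B \<longrightarrow> V = A \<union> B \<longrightarrow> V = A \<or> V = B)"

definition irreducible_chain ::
    "nat \<Rightarrow> 'k::comm_ring_1 vec set \<Rightarrow> nat \<Rightarrow> (nat \<Rightarrow> 'k vec set) \<Rightarrow> bool" where
  "irreducible_chain n V l Z \<longleftrightarrow>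
     (\<forall>i\<le>l. irreducible_closed n (Z i) \<and> Z i \<subseteq> V) \<and> (\<forall>i<l. Z i \<subset> Z (Suc i))"

definition variety_dim :: "nat \<Rightarrow> 'k::comm_ring_1 vec set \<Rightarrow> enat" where
  "variety_dim n V = (SUP l \<in> {l. \<exists>Z. irreducible_chain n V l Z}. enat l)"

definition morphism ::
    "nat \<Rightarrow> 'k::comm_ring_1 vec set \<Rightarrow> nat \<Rightarrow> 'k vec set \<Rightarrow> ('k vec \<Rightarrow> 'k vec) \<Rightarrow> bool" where
  "morphism n V m W f \<longleftrightarrow> f \<in> V \<rightarrow> W \<and> (\<forall>i<m. \<exists>p\<in>poly_funs n. \<forall>x\<in>V. f x $ i = p x)"

definition prod_variety :: "'k vec set \<Rightarrow> 'k vec set \<Rightarrow> 'k vec set" where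
  "prod_variety V W = {v @\<^sub>v w | v w. v \<in> V \<and> w \<in> W}"

definition Aut :: "nat \<Rightarrow> 'k::comm_ring_1 vec set \<Rightarrow> ('k vec \<Rightarrow> 'k vec) monoid" where
  "Aut n X = (BijGroup X)
     \<lparr>carrier := {f \<in> Bij X. morphism n X n X f \<and> morphism n X n X (inv_into X f)}\<rparr>"


section \<open>Affine algebraic groups and their actions\<close>

definition affine_alg_group :: "nat \<Rightarrow> 'k::comm_ring_1 vec monoid \<Rightarrow> bool" where
  "affine_alg_group n H \<longleftrightarrow> group H \<and> zariski_closed n (carrier H) \<and>
     morphism (n + n) (prod_variety (carrier H) (carrier H)) n (carrier H)
       (\<lambda>z. vec_first z n \<otimes>\<^bsub>H\<^esub> vec_last z n) \<and>
     morphism n (carrier H) n (carrier H) (\<lambda>x. inv\<^bsub>H\<^esub> x)"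

definition alg_group_iso :: "nat \<Rightarrow> 'k::comm_ring_1 vec monoid \<Rightarrow> nat \<Rightarrow> 'k vec monoid \<Rightarrow> bool" where
  "alg_group_iso n H m K \<longleftrightarrow> (\<exists>\<psi> \<in> iso H K.
     morphism n (carrier H) m (carrier K) \<psi> \<and>
     morphism m (carrier K) n (carrier H) (inv_into (carrier H) \<psi>))"

definition regular_action ::
    "nat \<Rightarrow> 'k::comm_ring_1 vec monoid \<Rightarrow> nat \<Rightarrow> 'k vec set \<Rightarrow> ('k vec \<Rightarrow> 'k vec \<Rightarrow> 'k vec) \<Rightarrow> bool" where
  "regular_action m H n X \<phi> \<longleftrightarrow> group_action H X \<phi> \<and>
     morphism (m + n) (prod_variety (carrier H) X) n X (\<lambda>z. \<phi> (vec_first z m) (vec_last z n))"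

abbreviation additive_alg_group :: "'k::comm_ring_1 vec monoid" where
  "additive_alg_group \<equiv> monoid_vec TYPE('k) 1"

text \<open>
  The direct product of k copies of the multiplicative group, each realised as the closed
  subset \<open>a * b = 1\<close> of the plane; the i-th copy has the coordinates 2i and 2i + 1.
\<close>

definition torus :: "nat \<Rightarrow> 'k::comm_ring_1 vec monoid" where
  "torus k =
    \<lparr>carrier = {v \<in> carrier_vec (2 * k). \<forall>i<k. v $ (2 * i) * v $ (2 * i + 1) = 1},
     monoid.mult = (\<lambda>v w. vec (2 * k) (\<lambda>i. v $ i * w $ i)),
     one = vec (2 * k) (\<lambda>_. 1)\<rparr>"

definition rigid :: "nat \<Rightarrow> 'k::comm_ring_1 vec set \<Rightarrow> bool" where
  "rigid n X \<longleftrightarrow> (\<forall>\<phi>. regular_action 1 additive_alg_group n X \<phi> \<longrightarrow>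
     (\<forall>g \<in> carrier additive_alg_group. \<forall>x \<in> X. \<phi> g x = x))"


section \<open>Algebraic subgroups and tori of the automorphism group\<close>

text \<open>
  A structure of an (affine) algebraic group on an abstract subgroup G of \<^term>\<open>Aut n X\<close>
  is given by an affine algebraic group H and an isomorphism of abstract groups from H onto G;
  the action of G on X is required to be a morphism.
\<close>

definition algebraic_structure ::
    "nat \<Rightarrow> 'k::comm_ring_1 vec set \<Rightarrow> ('k vec \<Rightarrow> 'k vec) set
      \<Rightarrow> nat \<Rightarrow> 'k vec monoid \<Rightarrow> ('k vec \<Rightarrow> 'k vec \<Rightarrow> 'k vec) \<Rightarrow> bool" where
  "algebraic_structure n X G m H \<phi> \<longleftrightarrow> subgroup G (Aut n X) \<and> affine_alg_group m H \<and>
     \<phi> \<in> iso H ((Aut n X)\<lparr>carrier := G\<rparr>) \<and> regular_action m H n X \<phi>"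

definition subtorus_structure ::
    "nat \<Rightarrow> 'k::comm_ring_1 vec set \<Rightarrow> ('k vec \<Rightarrow> 'k vec) set
      \<Rightarrow> nat \<Rightarrow> 'k vec monoid \<Rightarrow> ('k vec \<Rightarrow> 'k vec \<Rightarrow> 'k vec) \<Rightarrow> bool" where
  "subtorus_structure n X T m H \<phi> \<longleftrightarrow> algebraic_structure n X T m H \<phi> \<and>
     (\<exists>k. alg_group_iso m H (2 * k) (torus k))"

definition subtorus :: "nat \<Rightarrow> 'k::comm_ring_1 vec set \<Rightarrow> ('k vec \<Rightarrow> 'k vec) set \<Rightarrow> bool" where
  "subtorus n X T \<longleftrightarrow> (\<exists>m H \<phi>. subtorus_structure n X T m H \<phi>)"

definition maximal_torus :: "nat \<Rightarrow> 'k::comm_ring_1 vec set \<Rightarrow> ('k vec \<Rightarrow> 'k vec) set \<Rightarrow> bool" where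
  "maximal_torus n X T \<longleftrightarrow> subtorus n X T \<and> (\<forall>S. subtorus n X S \<longrightarrow> S \<subseteq> T)"

text \<open>
  In characteristic zero the algebraic structure on an algebraic subgroup is unique up to
  isomorphism, so the dimension does not depend on the structure chosen here.
\<close>

definition subtorus_has_dim ::
    "nat \<Rightarrow> 'k::comm_ring_1 vec set \<Rightarrow> ('k vec \<Rightarrow> 'k vec) set \<Rightarrow> nat \<Rightarrow> bool" where
  "subtorus_has_dim n X T r \<longleftrightarrow>
     (\<exists>m H \<phi>. subtorus_structure n X T m H \<phi> \<and> variety_dim m (carrier H) = enat r)"


section \<open>Abstract groups\<close>

definition centralizer :: "('a, 'b) monoid_scheme \<Rightarrow> 'a set \<Rightarrow> 'a set" where
  "centralizer G S = {g \<in> carrier G. \<forall>s\<in>S. g \<otimes>\<^bsub>G\<^esub> s = s \<otimes>\<^bsub>G\<^esub> g}"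

definition GL_int :: "nat \<Rightarrow> int mat monoid" where
  "GL_int r = units_of (ring_mat TYPE(int) r ())"

end

theory Submission
  imports Defs "HOL-Library.Function_Algebras"
begin

text \<open>
  Write \<open>T\<close> for the maximal torus. A conjugate of a subtorus is a subtorus (\<open>conj_subtorus\<close>), so by
  maximality \<open>T\<close> is normal in the automorphism group, which then acts on \<open>T\<close> by conjugation; the kernel
  of this action is the centralizer. It remains to see that each of these automorphisms of \<open>T\<close>, which are
  only known to be abstract group automorphisms, is given by an integer matrix in the parameters
  of \<open>T\<close>.

  Identify \<open>T\<close> with a standard torus with \<open>k\<close> factors. The regular functions on \<open>X\<close> decompose into weight
  functions (\<open>weight_decomposition\<close>). Let \<open>g\<close> be an automorphism and let \<open>c\<close> be the automorphism of
  the torus that conjugation by \<open>g\<close> induces. If \<open>q\<close> is a weight function for the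
  character \<open>\<chi>\<close>, then \<open>q \<circ> g\<close> is multiplied by \<open>\<chi> \<circ> c\<close> along the orbits of \<open>T\<close>. Hence \<open>\<chi> \<circ> c\<close> is a
  regular character, and by Dedekind's independence of characters it is a monomial
  (\<open>normalizing_weight\<close>). Since \<open>T\<close> acts faithfully, the weights have trivial common kernel; as
  characters of abelian groups with values in the nonzero elements of the field can be extended,
  a subgroup of the character lattice with trivial common kernel is the whole lattice
  (\<open>subgrp_exps_full\<close>). So \<open>c\<close> pulls every monomial back to a monomial, which means that it is
  a monomial map.

  The matrices of these maps give a homomorphism into the integral matrices of size \<open>k\<close> with the
  centralizer as its kernel (\<open>normal_torus_representation\<close>). An explicit chain of irreducible
  subgroups shows \<open>k \<le> r\<close> (\<open>torus_dim_ge\<close>). This inequality is enough: a matrix of size \<open>k\<close> can be padded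
  by an identity block to one of size \<open>r\<close>.
\<close>

section \<open>Linear independence of characters\<close>

text \<open>
  Dedekind's argument: comparing a relation at \<open>m x y\<close> with \<open>\<chi> b y\<close> times the relation at \<open>x\<close>
  cancels the term of \<open>b\<close> and multiplies that of every other \<open>a\<close> by \<open>\<chi> a y - \<chi> b y\<close>, which is
  nonzero for a suitable \<open>y\<close>. The index set keeps the characters abstract, so that a multiplicative
  function not yet known to be a monomial can be put next to the monomials.
\<close>

lemma dedekind_independence:
  fixes \<chi> :: "'i \<Rightarrow> 'a \<Rightarrow> 'k::field"
  assumes "finite S"
    and closed: "\<And>x y. x \<in> G \<Longrightarrow> y \<in> G \<Longrightarrow> m x y \<in> G"
    and mult: "\<And>a x y. a \<in> S \<Longrightarrow> x \<in> G \<Longrightarrow> y \<in> G \<Longrightarrow> \<chi> a (m x y) = \<chi> a x * \<chi> a y"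
    and nz: "\<And>a x. a \<in> S \<Longrightarrow> x \<in> G \<Longrightarrow> \<chi> a x \<noteq> 0"
    and ne: "G \<noteq> {}"
    and dist: "\<And>a b. a \<in> S \<Longrightarrow> b \<in> S \<Longrightarrow> a \<noteq> b \<Longrightarrow> \<exists>x\<in>G. \<chi> a x \<noteq> \<chi> b x"
    and zero: "\<And>x. x \<in> G \<Longrightarrow> (\<Sum>a\<in>S. c a * \<chi> a x) = 0"
    and "a \<in> S"
  shows "c a = 0"
  using assms
proof (induction S arbitrary: c a rule: finite_induct)
  case empty
  then show ?case by simp
next
  case (insert b S)
  have rest: "c a = 0" if a: "a \<in> S" for a
  proof -
    obtain y where y: "y \<in> G" "\<chi> a y \<noteq> \<chi> b y"
      using insert.prems(5)[of a b] a insert.hyps by auto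
    have "(\<Sum>a\<in>S. (c a * (\<chi> a y - \<chi> b y)) * \<chi> a x) = 0" if x: "x \<in> G" for x
    proof -
      have cancel: "A - B = 0" if "P + A = 0" "P + B = 0" for P A B :: 'k
        using that by (metis add_left_cancel eq_iff_diff_eq_0)
      have 1: "c b * \<chi> b x * \<chi> b y + (\<Sum>a\<in>S. c a * \<chi> a x * \<chi> a y) = 0"
      proof -
        have "(\<Sum>a\<in>insert b S. c a * \<chi> a x * \<chi> a y) = (\<Sum>a\<in>insert b S. c a * \<chi> a (m x y))"
          using insert.prems(2) x y by (intro sum.cong) (auto simp: mult.assoc)
        also have "\<dots> = 0"
          using insert.prems(6)[OF insert.prems(1)[OF x y(1)]] .
        finally show ?thesis using insert.hyps by simp
      qed
      have 2: "(c b * \<chi> b x + (\<Sum>a\<in>S. c a * \<chi> a x)) * \<chi> b y = 0"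
        using insert.prems(6)[OF x] insert.hyps by simp
      have "(\<Sum>a\<in>S. (c a * (\<chi> a y - \<chi> b y)) * \<chi> a x)
          = (\<Sum>a\<in>S. c a * \<chi> a x * \<chi> a y) - (\<Sum>a\<in>S. c a * \<chi> a x) * \<chi> b y"
        unfolding sum_distrib_right sum_subtractf[symmetric]
        by (intro sum.cong) (simp_all add: algebra_simps)
      also have "\<dots> = 0"
        using 1 2[unfolded distrib_right] by (rule cancel)
      finally show ?thesis .
    qed
    then have "c a * (\<chi> a y - \<chi> b y) = 0"
      by (intro insert.IH[where c = "\<lambda>a. c a * (\<chi> a y - \<chi> b y)"])
        (use insert.prems(1-5) a in \<open>simp_all\<close>)
    with y show ?thesis by simp
  qed
  obtain x where x: "x \<in> G" using insert.prems(4) by blast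
  have "c b * \<chi> b x = 0"
    using insert.prems(6)[OF x] insert.hyps rest by simp
  then have "c b = 0"
    using insert.prems(3)[of b x] x by simp
  then show ?case using rest insert.prems by auto
qed

section \<open>Extension of characters of abelian groups\<close>

definition subgrp :: "'a::ab_group_add set \<Rightarrow> bool" where
  "subgrp L \<longleftrightarrow> 0 \<in> L \<and> (\<forall>a\<in>L. \<forall>b\<in>L. a - b \<in> L)"

definition char_on :: "'a::ab_group_add set \<Rightarrow> ('a \<Rightarrow> 'k::field) \<Rightarrow> bool" where
  "char_on L h \<longleftrightarrow> (\<forall>a\<in>L. h a \<noteq> 0) \<and> (\<forall>a\<in>L. \<forall>b\<in>L. h (a + b) = h a * h b)"

lemma subgrpD:
  assumes "subgrp L"
  shows "0 \<in> L" "a \<in> L \<Longrightarrow> b \<in> L \<Longrightarrow> a - b \<in> L" "a \<in> L \<Longrightarrow> - a \<in> L"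
    "a \<in> L \<Longrightarrow> b \<in> L \<Longrightarrow> a + b \<in> L"
proof -
  show z: "0 \<in> L" and d: "a \<in> L \<Longrightarrow> b \<in> L \<Longrightarrow> a - b \<in> L" for a b
    using assms by (auto simp: subgrp_def)
  show m: "a \<in> L \<Longrightarrow> - a \<in> L" for a using d[OF z, of a] by simp
  show "a \<in> L \<Longrightarrow> b \<in> L \<Longrightarrow> a + b \<in> L" using d[of a "- b"] m[of b] by simp
qed

lemma char_onD:
  assumes "subgrp L" "char_on L h"
  shows "h 0 = 1" "a \<in> L \<Longrightarrow> h (- a) = inverse (h a)"
proof -
  have "h (0 + 0) = h 0 * h 0" "h 0 \<noteq> 0"
    using assms subgrpD(1)[of L] unfolding char_on_def by blast+
  then show 1: "h 0 = 1" by simp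
  assume a: "a \<in> L"
  have "h (- a + a) = h (- a) * h a" "h a \<noteq> 0"
    using assms subgrpD(3)[OF assms(1) a] a unfolding char_on_def by blast+
  then show "h (- a) = inverse (h a)" using 1 by (simp add: field_simps)
qed

lemma additive_hom:
  fixes s :: "int \<Rightarrow> 'a::ab_group_add"
  assumes "\<And>m n. s (m + n) = s m + s n"
  shows "s 0 = 0" "s (- n) = - s n" "s (m - n) = s m - s n"
proof -
  show z: "s 0 = 0" using assms[of 0 0] by simp
  show m: "s (- n) = - s n" for n
    using assms[of "- n" n] z by (simp add: eq_neg_iff_add_eq_0)
  show "s (m - n) = s m - s n" using assms[of m "- n"] m[of n] by simp
qed

text \<open>
  Here and below a homomorphism \<open>s\<close> from the integers stands for the multiples of the element
  \<open>s 1\<close>; with \<open>s\<close> the identity of the integers this also says that a subgroup of the integers is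
  closed under multiples.
\<close>

lemma char_on_powi:
  fixes s :: "int \<Rightarrow> 'a::ab_group_add" and f :: "'a \<Rightarrow> 'k::field"
  assumes L: "subgrp L" "char_on L f" and s: "\<And>m n. s (m + n) = s m + s n" and d: "s d \<in> L"
  shows "s (d * j) \<in> L \<and> f (s (d * j)) = f (s d) powi j"
proof -
  have nz: "f (s d) \<noteq> 0" using L d by (auto simp: char_on_def)
  show ?thesis
  proof (induction j rule: int_induct[of _ 0])
    case base
    then show ?case using additive_hom(1)[of s] s L subgrpD(1) char_onD(1) by auto
  next
    case (step1 i)
    have "s (d * (i + 1)) = s (d * i) + s d" by (simp add: algebra_simps s)
    then show ?case using step1 L d subgrpD(4)[OF L(1)] nz
      by (auto simp: char_on_def power_int_add)
  next
    case (step2 i)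
    have e: "s (d * (i - 1)) = s (d * i) + - s d"
      using additive_hom(3)[of s "d * i" d] s by (simp add: algebra_simps)
    have "f (s (d * i) + - s d) = f (s (d * i)) * f (- s d)"
      using L(2) step2 subgrpD(3)[OF L(1) d] unfolding char_on_def by blast
    moreover have "s (d * i) + - s d \<in> L"
      using step2 subgrpD(3)[OF L(1) d] subgrpD(4)[OF L(1)] by blast
    ultimately show ?case unfolding e using step2 char_onD(2)[OF L d] nz
      by (simp add: power_int_diff divide_inverse)
  qed
qed

lemma int_subgroup_principal:
  assumes "subgrp (D :: int set)"
  obtains "D = {0}" | d where "d > 0" "D = {d * j | j. True}"
proof (cases "D = {0}")
  case False
  define P where "P n \<longleftrightarrow> n > 0 \<and> int n \<in> D" for n :: nat
  obtain x where "x \<in> D" "x \<noteq> 0" using False subgrpD(1)[OF assms] by blast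
  then have "\<bar>x\<bar> \<in> D" "\<bar>x\<bar> > 0" using subgrpD(3)[OF assms, of x] by (auto simp: abs_if)
  then have "P (nat \<bar>x\<bar>)" by (simp add: P_def)
  then have P: "P (LEAST n. P n)" by (rule LeastI)
  define d where "d = int (LEAST n. P n)"
  have d: "d > 0" "d \<in> D" using P by (auto simp: P_def d_def)
  \<comment> \<open>A constant character, as only membership is wanted.\<close>
  have mem: "d * j \<in> D" for j
    using char_on_powi[of D "\<lambda>x::int. 1::rat" "\<lambda>x. x" d j] assms d by (simp add: char_on_def)
  have "\<exists>j. x = d * j" if x: "x \<in> D" for x
  proof -
    have "x mod d \<in> D"
      using subgrpD(2)[OF assms x mem[of "x div d"]] by (simp add: minus_mult_div_eq_mod)
    moreover have "0 \<le> x mod d" "x mod d < d" using d by auto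
    ultimately have "x mod d = 0"
      using not_less_Least[of "nat (x mod d)" P] by (force simp: P_def d_def)
    then have "d dvd x" by auto
    then show ?thesis by (auto simp: dvd_def)
  qed
  then have "D = {d * j | j. True}" using mem by auto
  then show ?thesis using that(2) d by blast
qed (use that in blast)

text \<open>
  The polynomial \<open>1 + z + \<dots> + z ^ (d - 1)\<close> has a root, and in characteristic zero its value at 1,
  which is \<open>d\<close>, does not vanish.
\<close>

lemma nontrivial_root_of_unity:
  fixes d :: nat
  assumes "d \<ge> 2"
  obtains z :: "'k::{alg_closed_field, field_char_0}" where "z ^ d = 1" "z \<noteq> 1"
proof -
  obtain z :: 'k where z: "(\<Sum>k\<le>d - 1. 1 * z ^ k) = 0"
    using alg_closed[of "d - 1" "\<lambda>_. 1"] assms by auto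
  have "{..d - 1} = {..<d}" using assms by auto
  then have z': "(\<Sum>k<d. z ^ k) = 0" using z by simp
  have "z ^ d = 1" using power_diff_1_eq[of z d] z' by simp
  moreover have "z \<noteq> 1"
  proof
    assume "z = 1"
    with z' have "of_nat d = (0::'k)" by simp
    then show False using assms by simp
  qed
  ultimately show ?thesis using that by blast
qed

text \<open>
  The value \<open>z\<close> that an extension of \<open>f\<close> takes at \<open>s 1\<close>. The multiples of \<open>s 1\<close> that lie in \<open>L\<close> are
  those of one number \<open>d\<close>. If \<open>d = 0\<close> any nonzero \<open>z\<close> will do; otherwise \<open>z\<close> has to be a \<open>d\<close>-th root
  of \<open>f (s d)\<close>, which exists because the field is algebraically closed. When \<open>s 1\<close> is outside \<open>L\<close>
  we have \<open>d \<noteq> 1\<close>, and this leaves room for \<open>z \<noteq> 1\<close> even if \<open>f\<close> is trivial.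
\<close>

lemma extension_value:
  fixes f :: "'a::ab_group_add \<Rightarrow> 'k::{alg_closed_field, field_char_0}" and s :: "int \<Rightarrow> 'a"
  assumes L: "subgrp L" "char_on L f" and s: "\<And>m n. s (m + n) = s m + s n"
  obtains z where "z \<noteq> 0" "\<And>n. s n \<in> L \<Longrightarrow> f (s n) = z powi n"
    "s 1 \<notin> L \<Longrightarrow> (\<And>a. a \<in> L \<Longrightarrow> f a = 1) \<Longrightarrow> z \<noteq> 1"
proof -
  have D: "subgrp {n. s n \<in> L}"
    using L(1) additive_hom[of s] s by (auto simp: subgrp_def)
  show ?thesis
  proof (rule int_subgroup_principal[OF D])
    assume D0: "{n. s n \<in> L} = {0}"
    show ?thesis
    proof (rule that[of 2])
      show "f (s n) = 2 powi n" if "s n \<in> L" for n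
      proof -
        have "n = 0" using that D0 by blast
        then show ?thesis using additive_hom(1)[of s] s char_onD(1)[OF L] by simp
      qed
    qed auto
  next
    fix d assume d: "d > 0" and DD: "{n. s n \<in> L} = {d * j | j. True}"
    have sd: "s d \<in> L"
    proof -
      have "d * 1 \<in> {n. s n \<in> L}" unfolding DD by blast
      then show ?thesis by simp
    qed
    have key: "\<exists>z. z ^ nat d = f (s d) \<and> (s 1 \<notin> L \<longrightarrow> (\<forall>a\<in>L. f a = 1) \<longrightarrow> z \<noteq> 1)"
    proof (cases "s 1 \<notin> L \<and> (\<forall>a\<in>L. f a = 1)")
      case True
      then have "d \<noteq> 1" using sd by auto
      then have "nat d \<ge> 2" using d by linarith
      then show ?thesis using nontrivial_root_of_unity True sd by metis
    next
      case False
      then show ?thesis using nth_root_exists[of "nat d" "f (s d)"] d by auto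
    qed
    then obtain z where z: "z ^ nat d = f (s d)" "s 1 \<notin> L \<longrightarrow> (\<forall>a\<in>L. f a = 1) \<longrightarrow> z \<noteq> 1" by blast
    have zd: "z powi d = f (s d)" using z(1) d by (simp add: power_int_def)
    show ?thesis
    proof (rule that[of z])
      show "z \<noteq> 0" using z(1) L(2) sd d by (auto simp: char_on_def power_0_left)
      show "f (s n) = z powi n" if "s n \<in> L" for n
      proof -
        have "n \<in> {d * j | j. True}" using that unfolding DD[symmetric] by simp
        then obtain j where j: "n = d * j" by blast
        show ?thesis using char_on_powi[OF L s sd, of j] zd by (simp add: j power_int_mult)
      qed
    qed (use z in auto)
  qed
qed

text \<open>
  The multiplicative group of the field is divisible, so characters extend from \<open>L\<close> to the group
  generated by \<open>L\<close> and \<open>s 1\<close>; since it also has torsion of every order, an element outside \<open>L\<close> can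
  be separated from \<open>L\<close>.
\<close>

lemma char_extend:
  fixes f :: "'a::ab_group_add \<Rightarrow> 'k::{alg_closed_field, field_char_0}" and s :: "int \<Rightarrow> 'a"
  assumes L: "subgrp L" "char_on L f" and s: "\<And>m n. s (m + n) = s m + s n"
  obtains L' f' where "subgrp L'" "char_on L' f'" "L \<subseteq> L'" "s 1 \<in> L'" "\<And>a. a \<in> L \<Longrightarrow> f' a = f a"
    "s 1 \<notin> L \<Longrightarrow> (\<And>a. a \<in> L \<Longrightarrow> f a = 1) \<Longrightarrow> f' (s 1) \<noteq> 1"
proof -
  obtain z where z: "z \<noteq> 0" "\<And>n. s n \<in> L \<Longrightarrow> f (s n) = z powi n"
    "s 1 \<notin> L \<Longrightarrow> (\<And>a. a \<in> L \<Longrightarrow> f a = 1) \<Longrightarrow> z \<noteq> 1"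
    using extension_value[of L f s] assms by blast
  note sh = additive_hom[of s, OF s]
  note LD = subgrpD[OF L(1)]
  define L' where "L' = {a + s n | a n. a \<in> L}"
  define R where "R b y \<longleftrightarrow> (\<exists>a n. a \<in> L \<and> b = a + s n \<and> y = f a * z powi n)" for b y
  have uniq: "y = y'" if R: "R b y" "R b y'" for b y y'
  proof -
    obtain a n a' n' where r: "a \<in> L" "b = a + s n" "y = f a * z powi n"
       "a' \<in> L" "b = a' + s n'" "y' = f a' * z powi n'" using R unfolding R_def by blast
    have e: "s (n - n') = a' - a" using r by (simp add: sh(3) algebra_simps)
    then have "s (n - n') \<in> L" using LD r by simp
    then have "f (a' - a) = z powi (n - n')" using z(2) e by metis
    moreover have "f a' = f a * f (a' - a)"
    proof -
      have "f (a + (a' - a)) = f a * f (a' - a)"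
        using L(2) r(1) LD(2)[OF r(4,1)] unfolding char_on_def by blast
      then show ?thesis by simp
    qed
    ultimately show ?thesis using r z(1) by (simp add: power_int_diff)
  qed
  define f' where "f' b = (THE y. R b y)" for b
  have f': "f' (a + s n) = f a * z powi n" if "a \<in> L" for a n
  proof -
    have "R (a + s n) (f a * z powi n)" using that by (auto simp: R_def)
    then show ?thesis unfolding f'_def using uniq by (intro the_equality) blast+
  qed
  show ?thesis
  proof (rule that[of L' f'])
    show "subgrp L'" unfolding subgrp_def
    proof (intro conjI ballI)
      show "0 \<in> L'" unfolding L'_def using LD(1) sh(1) by force
      fix a b assume "a \<in> L'" "b \<in> L'"
      then obtain a1 n b1 m where r: "a1 \<in> L" "a = a1 + s n" "b1 \<in> L" "b = b1 + s m"
        unfolding L'_def by blast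
      then have "a - b = (a1 - b1) + s (n - m)" by (simp add: sh(3))
      then show "a - b \<in> L'" unfolding L'_def using LD(2)[OF r(1,3)] by blast
    qed
    show "char_on L' f'" unfolding char_on_def
    proof (intro conjI ballI)
      fix a assume "a \<in> L'"
      then obtain a1 n where r: "a1 \<in> L" "a = a1 + s n" unfolding L'_def by blast
      then show "f' a \<noteq> 0" using f'[of a1 n] z(1) L(2) by (auto simp: char_on_def)
      fix b assume "b \<in> L'"
      then obtain b1 m where q: "b1 \<in> L" "b = b1 + s m" unfolding L'_def by blast
      have e: "a + b = (a1 + b1) + s (n + m)" using r q by (simp add: s)
      have "f' (a + b) = f (a1 + b1) * z powi (n + m)" unfolding e using f' LD(4) r(1) q(1) by blast
      also have "\<dots> = f' a * f' b" using f' r q z(1) L(2)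
        by (simp add: char_on_def power_int_add)
      finally show "f' (a + b) = f' a * f' b" .
    qed
    show "L \<subseteq> L'" unfolding L'_def using sh(1) by force
    show "s 1 \<in> L'" unfolding L'_def using LD(1) by force
    show "f' a = f a" if "a \<in> L" for a using f'[OF that, of 0] sh(1) by simp
    show "f' (s 1) \<noteq> 1" if "s 1 \<notin> L" "\<And>a. a \<in> L \<Longrightarrow> f a = 1"
      using f'[OF LD(1), of 1] z(3)[OF that] char_onD(1)[OF L] by simp
  qed
qed

section \<open>Polynomial functions\<close>

lemma poly_funs_sum:
  assumes "finite I" "\<And>i. i \<in> I \<Longrightarrow> p i \<in> poly_funs n"
  shows "(\<lambda>x. \<Sum>i\<in>I. p i x) \<in> poly_funs n"
  using assms by (induction I rule: finite_induct) (auto intro: poly_funs.intros)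

lemma poly_funs_comp:
  assumes "p \<in> poly_funs m" and "\<And>i. i < m \<Longrightarrow> \<exists>q\<in>poly_funs n. \<forall>x\<in>V. f x $ i = q x"
  shows "\<exists>q\<in>poly_funs n. \<forall>x\<in>V. p (f x) = q x"
  using assms(1)
proof induction
  case (const c)
  show ?case by (rule bexI[of _ "\<lambda>_. c"]) (auto intro: poly_funs.intros)
next
  case (coord i)
  then show ?case using assms(2) by blast
next
  case (add p q)
  then obtain p' q' where "p' \<in> poly_funs n" "q' \<in> poly_funs n"
    "\<forall>x\<in>V. p (f x) = p' x" "\<forall>x\<in>V. q (f x) = q' x" by blast
  then show ?case by (intro bexI[of _ "\<lambda>x. p' x + q' x"]) (auto intro: poly_funs.intros)
next
  case (mult p q)
  then obtain p' q' where "p' \<in> poly_funs n" "q' \<in> poly_funs n"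
    "\<forall>x\<in>V. p (f x) = p' x" "\<forall>x\<in>V. q (f x) = q' x" by blast
  then show ?case by (intro bexI[of _ "\<lambda>x. p' x * q' x"]) (auto intro: poly_funs.intros)
qed

section \<open>Monomials on the torus\<close>

abbreviation torus_pts :: "nat \<Rightarrow> 'k::field vec set" where
  "torus_pts k \<equiv> carrier (torus k)"

text \<open>
  The Laurent monomial with exponent vector \<open>a\<close>. The coordinate \<open>2 * i\<close> of a point of the torus is
  the parameter of the i-th factor and the coordinate \<open>2 * i + 1\<close> is its inverse. Exponent vectors
  are functions vanishing from \<open>k\<close> on, so that distinct ones give distinct monomials.
\<close>

definition tmon :: "nat \<Rightarrow> (nat \<Rightarrow> int) \<Rightarrow> 'k::field vec \<Rightarrow> 'k" where
  "tmon k a v = (\<Prod>i<k. v $ (2 * i) powi a i)"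

definition exps :: "nat \<Rightarrow> (nat \<Rightarrow> int) set" where
  "exps k = {a. \<forall>i\<ge>k. a i = 0}"

definition unit_exp :: "nat \<Rightarrow> int \<Rightarrow> nat \<Rightarrow> int" where
  "unit_exp i m = (\<lambda>j. if j = i then m else 0)"

definition torus_pt :: "nat \<Rightarrow> (nat \<Rightarrow> 'k::field) \<Rightarrow> 'k vec" where
  "torus_pt k u = vec (2 * k) (\<lambda>j. if even j then u (j div 2) else inverse (u (j div 2)))"

lemma torus_pts_iff:
  "v \<in> torus_pts k \<longleftrightarrow> v \<in> carrier_vec (2 * k) \<and> (\<forall>i<k. v $ (2 * i) * v $ (2 * i + 1) = 1)"
  by (simp add: torus_def)

lemma torus_mult_def: "v \<otimes>\<^bsub>torus k\<^esub> w = vec (2 * k) (\<lambda>i. v $ i * w $ i)"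
  by (simp add: torus_def)

lemma torus_one_def: "\<one>\<^bsub>torus k\<^esub> = vec (2 * k) (\<lambda>_. 1)"
  by (simp add: torus_def)

lemma torus_coord_nz: "v \<in> torus_pts k \<Longrightarrow> i < k \<Longrightarrow> v $ (2 * i) \<noteq> 0"
  by (auto simp: torus_pts_iff)

lemma torus_coord_odd: "v \<in> torus_pts k \<Longrightarrow> i < k \<Longrightarrow> v $ (2 * i + 1) = inverse (v $ (2 * i))"
  by (auto simp: torus_pts_iff intro: inverse_unique[symmetric])

lemma torus_mult_closed:
  fixes v w :: "'k::field vec"
  shows "v \<in> torus_pts k \<Longrightarrow> w \<in> torus_pts k \<Longrightarrow> v \<otimes>\<^bsub>torus k\<^esub> w \<in> torus_pts k"
  unfolding torus_pts_iff torus_mult_def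
  by (auto simp: mult.assoc mult.left_commute[of "w $ _" "v $ _"])

lemma torus_one_closed: "\<one>\<^bsub>torus k\<^esub> \<in> torus_pts k"
  by (auto simp: torus_pts_iff torus_one_def)

lemma torus_mult_one: "v \<in> torus_pts k \<Longrightarrow> v \<otimes>\<^bsub>torus k\<^esub> \<one>\<^bsub>torus k\<^esub> = v"
  by (auto simp: torus_mult_def torus_one_def torus_pts_iff)

lemma torus_eqI:
  assumes "v \<in> torus_pts k" "w \<in> torus_pts k" "\<And>i. i < k \<Longrightarrow> v $ (2 * i) = w $ (2 * i)"
  shows "v = w"
proof (rule eq_vecI)
  have d: "dim_vec v = 2 * k" "dim_vec w = 2 * k" using assms by (auto simp: torus_pts_iff)
  then show "dim_vec v = dim_vec w" by simp
  fix j assume "j < dim_vec w"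
  then have j: "j div 2 < k" using d by auto
  show "v $ j = w $ j"
  proof (cases "even j")
    case True
    then show ?thesis using assms(3)[OF j] by simp
  next
    case False
    then have "j = 2 * (j div 2) + 1" by simp
    then show ?thesis
      using assms(3)[OF j] torus_coord_odd[OF assms(1) j] torus_coord_odd[OF assms(2) j] by metis
  qed
qed

lemma torus_pt_mem: "(\<And>i. i < k \<Longrightarrow> u i \<noteq> 0) \<Longrightarrow> torus_pt k u \<in> torus_pts k"
  by (auto simp: torus_pts_iff torus_pt_def)

lemma torus_pt_coord: "i < k \<Longrightarrow> torus_pt k u $ (2 * i) = u i"
  by (simp add: torus_pt_def)

lemma tmon_torus_pt: "tmon k a (torus_pt k u) = (\<Prod>i<k. u i powi a i)"
  by (simp add: tmon_def torus_pt_coord)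

lemma tmon_nz: "v \<in> torus_pts k \<Longrightarrow> tmon k a v \<noteq> 0"
  by (auto simp: tmon_def dest: torus_coord_nz)

lemma tmon_mult: "tmon k a (v \<otimes>\<^bsub>torus k\<^esub> w) = tmon k a v * tmon k a w"
  by (simp add: tmon_def torus_mult_def power_int_mult_distrib prod.distrib)

lemma tmon_add: "v \<in> torus_pts k \<Longrightarrow> tmon k (a + b) v = tmon k a v * tmon k b v"
  by (simp add: tmon_def prod.distrib[symmetric] power_int_add torus_coord_nz)

lemma tmon_zero: "tmon k 0 v = 1" "tmon k (\<lambda>_. 0) v = 1"
  by (simp_all add: tmon_def)

lemma tmon_diff: "v \<in> torus_pts k \<Longrightarrow> tmon k (a - b) v = tmon k a v / tmon k b v"
  by (simp add: tmon_def prod_dividef[symmetric] power_int_diff torus_coord_nz)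

lemma tmon_unit: "i < k \<Longrightarrow> tmon k (unit_exp i m) v = v $ (2 * i) powi m"
proof -
  assume "i < k"
  have "tmon k (unit_exp i m) v = (\<Prod>j<k. if j = i then v $ (2 * i) powi m else 1)"
    unfolding tmon_def unit_exp_def by (intro prod.cong) auto
  then show ?thesis using \<open>i < k\<close> by simp
qed

lemma exps_subgrp: "subgrp (exps k)"
  by (auto simp: subgrp_def exps_def)

lemma unit_exp_exps: "i < k \<Longrightarrow> unit_exp i m \<in> exps k"
  by (auto simp: exps_def unit_exp_def)

lemma two_powi_inj:
  assumes "(2 :: 'k::field_char_0) powi m = 2 powi n"
  shows "m = n"
proof -
  have *: "m = n" if "n \<le> m" "(2 :: 'k) powi m = 2 powi n" for m n
  proof -
    have "(2 :: 'k) powi (m - n) = 1" using that by (simp add: power_int_diff)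
    then have "(2 :: 'k) ^ nat (m - n) = 1" using that by (simp add: power_int_def)
    then have "(of_nat (2 ^ nat (m - n)) :: 'k) = of_nat 1" by simp
    then have "(2::nat) ^ nat (m - n) = 1" unfolding of_nat_eq_iff .
    then show ?thesis using that(1) by simp
  qed
  show ?thesis using *[OF _ assms] *[OF _ assms[symmetric]] linear[of n m] by blast
qed

lemma tmon_separate:
  assumes "a \<in> exps k" "b \<in> exps k" "a \<noteq> b"
  shows "\<exists>v\<in>torus_pts k. tmon k a v \<noteq> (tmon k b v :: 'k::field_char_0)"
proof -
  obtain i where i: "a i \<noteq> b i" using assms by auto
  then have "i < k" using assms by (auto simp: exps_def not_le[symmetric])
  define v :: "'k vec" where "v = torus_pt k (\<lambda>j. if j = i then 2 else 1)"
  have "tmon k a v = 2 powi a i" for a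
  proof -
    have "tmon k a v = (\<Prod>j<k. if j = i then 2 powi a i else 1)"
      unfolding v_def tmon_torus_pt by (intro prod.cong) auto
    then show ?thesis using \<open>i < k\<close> by simp
  qed
  moreover have "v \<in> torus_pts k" unfolding v_def by (rule torus_pt_mem) auto
  ultimately show ?thesis using i two_powi_inj by metis
qed

lemma tmon_independent:
  fixes c :: "(nat \<Rightarrow> int) \<Rightarrow> 'k::field_char_0"
  assumes "finite S" "S \<subseteq> exps k" "\<And>v. v \<in> torus_pts k \<Longrightarrow> (\<Sum>a\<in>S. c a * tmon k a v) = 0" "a \<in> S"
  shows "c a = 0"
proof (rule dedekind_independence[of S "torus_pts k" "\<lambda>v w. v \<otimes>\<^bsub>torus k\<^esub> w" "tmon k" c])
  show "\<exists>x\<in>torus_pts k. tmon k a x \<noteq> (tmon k b x :: 'k)" if "a \<in> S" "b \<in> S" "a \<noteq> b" for a b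
    using tmon_separate that assms(2) by blast
qed (use assms torus_one_closed in \<open>auto simp: tmon_mult tmon_nz torus_mult_closed\<close>)

text \<open>
  Otherwise the character would be independent of the monomials in its own expansion.
\<close>

lemma regular_character_is_tmon:
  fixes \<theta> :: "'k::field_char_0 vec \<Rightarrow> 'k"
  assumes "finite S" "S \<subseteq> exps k"
    and mult: "\<And>v w. v \<in> torus_pts k \<Longrightarrow> w \<in> torus_pts k \<Longrightarrow> \<theta> (v \<otimes>\<^bsub>torus k\<^esub> w) = \<theta> v * \<theta> w"
    and nz: "\<And>v. v \<in> torus_pts k \<Longrightarrow> \<theta> v \<noteq> 0"
    and sum: "\<And>v. v \<in> torus_pts k \<Longrightarrow> \<theta> v = (\<Sum>b\<in>S. c b * tmon k b v)"
  shows "\<exists>b\<in>S. \<forall>v\<in>torus_pts k. \<theta> v = tmon k b v"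
proof (rule ccontr)
  assume neg: "\<not> ?thesis"
  \<comment> \<open>The index \<open>None\<close> stands for \<open>\<theta>\<close>; its coefficient -1 turns the expansion into a relation.\<close>
  define \<chi> where "\<chi> o' = (case o' of None \<Rightarrow> \<theta> | Some b \<Rightarrow> tmon k b)" for o' :: "(nat \<Rightarrow> int) option"
  define d where "d o' = (case o' of None \<Rightarrow> -1 | Some b \<Rightarrow> c b)" for o' :: "(nat \<Rightarrow> int) option"
  have "d None = 0"
  proof (rule dedekind_independence[of "insert None (Some ` S)" "torus_pts k"
        "\<lambda>v w. v \<otimes>\<^bsub>torus k\<^esub> w" \<chi> d])
    show "\<exists>x\<in>torus_pts k. \<chi> a x \<noteq> \<chi> b x"
      if "a \<in> insert None (Some ` S)" "b \<in> insert None (Some ` S)" "a \<noteq> b" for a b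
    proof (cases a)
      case None
      then show ?thesis using that neg by (auto simp: \<chi>_def)
    next
      case (Some a')
      show ?thesis
      proof (cases b)
        case None
        then show ?thesis using that neg Some by (auto simp: \<chi>_def) metis
      next
        case (Some b')
        then show ?thesis
          using that \<open>a = Some a'\<close> tmon_separate[of a' k b'] assms(2) by (auto simp: \<chi>_def)
      qed
    qed
    show "(\<Sum>a\<in>insert None (Some ` S). d a * \<chi> a x) = 0" if "x \<in> torus_pts k" for x
      using sum[OF that] assms(1) by (simp add: sum.reindex d_def \<chi>_def)
    show "torus_pts k \<noteq> ({} :: 'k vec set)" using torus_one_closed by blast
  qed (use assms(1) mult nz in
      \<open>auto simp: \<chi>_def tmon_mult tmon_nz torus_mult_closed split: option.splits\<close>)
  then show False by (simp add: d_def)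
qed

text \<open>
  A regular function on the product of a torus and an affine space is a Laurent polynomial in the
  parameters of the torus with polynomial coefficients.
\<close>

lemma laurent_expansion:
  fixes p :: "'k::field vec \<Rightarrow> 'k"
  assumes "p \<in> poly_funs (2 * k + n)"
  shows "\<exists>S q. finite S \<and> S \<subseteq> exps k \<and> (\<forall>a. q a \<in> poly_funs n) \<and>
    (\<forall>v\<in>torus_pts k. \<forall>x\<in>carrier_vec n. p (v @\<^sub>v x) = (\<Sum>a\<in>S. tmon k a v * q a x))"
  using assms
proof induction
  case (const c)
  show ?case
    by (rule exI[of _ "{0}"], rule exI[of _ "\<lambda>_ _. c"])
      (auto simp: tmon_zero subgrpD(1)[OF exps_subgrp] intro: poly_funs.intros)
next
  case (coord i)
  consider (even) j where "j < k" "i = 2 * j" | (odd) j where "j < k" "i = 2 * j + 1"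
    | (last) j where "j < n" "i = 2 * k + j"
  proof -
    have "(\<exists>j<k. i = 2 * j) \<or> (\<exists>j<k. i = 2 * j + 1) \<or> (\<exists>j<n. i = 2 * k + j)"
    proof (cases "i < 2 * k")
      case True
      then have "i div 2 < k" by auto
      moreover have "i = 2 * (i div 2) \<or> i = 2 * (i div 2) + 1" by presburger
      ultimately show ?thesis by blast
    next
      case False
      then show ?thesis using coord by (intro disjI2 exI[of _ "i - 2 * k"]) auto
    qed
    then show ?thesis using that by blast
  qed
  then show ?case
  proof cases
    case even
    then show ?thesis
      by (intro exI[of _ "{unit_exp j 1}"] exI[of _ "\<lambda>_ _. 1"])
        (auto simp: tmon_unit unit_exp_exps torus_pts_iff intro: poly_funs.intros)
  next
    case odd
    have "(v @\<^sub>v x) $ i = inverse (v $ (2 * j))" if "v \<in> torus_pts k" for v x :: "'k vec"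
      using torus_coord_odd[OF that odd(1)] that odd by (auto simp: torus_pts_iff)
    then show ?thesis using odd
      by (intro exI[of _ "{unit_exp j (-1)}"] exI[of _ "\<lambda>_ _. 1"])
        (auto simp: tmon_unit unit_exp_exps intro: poly_funs.intros)
  next
    case last
    then show ?thesis
      by (intro exI[of _ "{0}"] exI[of _ "\<lambda>_ x. x $ j"])
        (auto simp: tmon_zero subgrpD(1)[OF exps_subgrp] torus_pts_iff intro: poly_funs.intros)
  qed
next
  case (add p p')
  then obtain S q S' q' where
    S: "finite S" "S \<subseteq> exps k" "\<forall>a. q a \<in> poly_funs n"
      "\<forall>v\<in>torus_pts k. \<forall>x\<in>carrier_vec n. p (v @\<^sub>v x) = (\<Sum>a\<in>S. tmon k a v * q a x)"
    and S': "finite S'" "S' \<subseteq> exps k" "\<forall>a. q' a \<in> poly_funs n"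
      "\<forall>v\<in>torus_pts k. \<forall>x\<in>carrier_vec n. p' (v @\<^sub>v x) = (\<Sum>a\<in>S'. tmon k a v * q' a x)"
    by blast
  define r where "r a x = (if a \<in> S then q a x else 0) + (if a \<in> S' then q' a x else 0)" for a x
  have "r a \<in> poly_funs n" for a
    unfolding r_def using S(3) S'(3) by (cases "a \<in> S"; cases "a \<in> S'") (auto intro: poly_funs.intros)
  moreover have "(\<Sum>a\<in>S \<union> S'. tmon k a v * r a x)
      = (\<Sum>a\<in>S. tmon k a v * q a x) + (\<Sum>a\<in>S'. tmon k a v * q' a x)" for v x
  proof -
    have "(\<Sum>a\<in>S \<union> S'. tmon k a v * r a x)
      = (\<Sum>a\<in>S \<union> S'. if a \<in> S then tmon k a v * q a x else 0)
        + (\<Sum>a\<in>S \<union> S'. if a \<in> S' then tmon k a v * q' a x else 0)"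
      unfolding sum.distrib[symmetric] r_def by (intro sum.cong) (auto simp: algebra_simps)
    also have "\<dots> = (\<Sum>a\<in>(S \<union> S') \<inter> S. tmon k a v * q a x) + (\<Sum>a\<in>(S \<union> S') \<inter> S'. tmon k a v * q' a x)"
      by (simp only: sum.inter_restrict[of "S \<union> S'"] finite_Un S(1) S'(1) simp_thms)
    finally show ?thesis by (simp add: Int_absorb1)
  qed
  ultimately show ?case using S S' by (intro exI[of _ "S \<union> S'"] exI[of _ r]) auto
next
  case (mult p p')
  then obtain S q S' q' where
    S: "finite S" "S \<subseteq> exps k" "\<forall>a. q a \<in> poly_funs n"
      "\<forall>v\<in>torus_pts k. \<forall>x\<in>carrier_vec n. p (v @\<^sub>v x) = (\<Sum>a\<in>S. tmon k a v * q a x)"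
    and S': "finite S'" "S' \<subseteq> exps k" "\<forall>a. q' a \<in> poly_funs n"
      "\<forall>v\<in>torus_pts k. \<forall>x\<in>carrier_vec n. p' (v @\<^sub>v x) = (\<Sum>a\<in>S'. tmon k a v * q' a x)"
    by blast
  define U where "U = (\<lambda>(a, b). a + b) ` (S \<times> S')"
  define r where "r c x = (\<Sum>z\<in>{z \<in> S \<times> S'. (\<lambda>(a, b). a + b) z = c}. q (fst z) x * q' (snd z) x)" for c x
  have fin: "finite (S \<times> S')" using S S' by simp
  have "r c \<in> poly_funs n" for c
    unfolding r_def using fin S(3) S'(3)
    by (intro poly_funs_sum) (auto intro: poly_funs.intros)
  moreover have "p (v @\<^sub>v x) * p' (v @\<^sub>v x) = (\<Sum>c\<in>U. tmon k c v * r c x)"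
    if v: "v \<in> torus_pts k" and x: "x \<in> carrier_vec n" for v x
  proof -
    have "p (v @\<^sub>v x) * p' (v @\<^sub>v x)
        = (\<Sum>z\<in>S \<times> S'. tmon k (fst z) v * q (fst z) x * (tmon k (snd z) v * q' (snd z) x))"
      using S(4) S'(4) v x by (simp add: sum_product sum.cartesian_product split_beta)
    also have "\<dots> = (\<Sum>z\<in>S \<times> S'. tmon k (fst z + snd z) v * (q (fst z) x * q' (snd z) x))"
      by (intro sum.cong) (auto simp: tmon_add[OF v])
    also have "\<dots> = (\<Sum>c\<in>U. \<Sum>z\<in>{z \<in> S \<times> S'. (\<lambda>(a, b). a + b) z = c}.
         tmon k (fst z + snd z) v * (q (fst z) x * q' (snd z) x))"
      using fin by (intro sum.group[symmetric]) (auto simp: U_def)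
    also have "\<dots> = (\<Sum>c\<in>U. tmon k c v * r c x)"
      unfolding r_def sum_distrib_left by (intro sum.cong) auto
    finally show ?thesis .
  qed
  moreover have "U \<subseteq> exps k"
    using S(2) S'(2) subgrpD(4)[OF exps_subgrp] by (fastforce simp: U_def)
  moreover have "finite U" using fin by (simp add: U_def)
  ultimately show ?case by (intro exI[of _ U] exI[of _ r]) auto
qed

text \<open>
  Duality between the torus and its character lattice. If \<open>b\<close> were outside \<open>L\<close>, a character that is
  trivial on \<open>L\<close> but not at \<open>b\<close> could be extended to the whole lattice, one basis vector at a time;
  its values at the basis vectors are the parameters of a nontrivial point at which all monomials
  of \<open>L\<close> take the value 1.
\<close>

lemma subgrp_exps_full:
  assumes L: "subgrp L" "L \<subseteq> exps k"
    and triv: "\<And>v :: 'k::{alg_closed_field, field_char_0} vec. v \<in> torus_pts k \<Longrightarrow>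
      (\<And>a. a \<in> L \<Longrightarrow> tmon k a v = 1) \<Longrightarrow> v = \<one>\<^bsub>torus k\<^esub>"
  shows "L = exps k"
proof (rule ccontr)
  assume "L \<noteq> exps k"
  then obtain b where b: "b \<in> exps k" "b \<notin> L" using L by blast
  define s :: "int \<Rightarrow> nat \<Rightarrow> int" where "s n = (\<lambda>i. n * b i)" for n
  have "char_on L (\<lambda>_. 1 :: 'k)" by (simp add: char_on_def)
  then obtain L0 and f0 :: "(nat \<Rightarrow> int) \<Rightarrow> 'k" where
    0: "subgrp L0" "char_on L0 f0" "L \<subseteq> L0" "\<And>a. a \<in> L \<Longrightarrow> f0 a = 1" "b \<in> L0" "f0 b \<noteq> 1"
    using b by (rule_tac char_extend[OF L(1), of "\<lambda>_. 1 :: 'k" s]) (auto simp: s_def algebra_simps fun_eq_iff)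
  have "\<exists>L' f'. subgrp L' \<and> char_on L' (f' :: _ \<Rightarrow> 'k) \<and> L0 \<subseteq> L' \<and> (\<forall>a\<in>L0. f' a = f0 a) \<and>
      (\<forall>i<j. unit_exp i 1 \<in> L')" for j
  proof (induction j)
    case 0
    then show ?case using \<open>subgrp L0\<close> \<open>char_on L0 f0\<close> by auto
  next
    case (Suc j)
    then obtain L' f' where 1: "subgrp L'" "char_on L' (f' :: _ \<Rightarrow> 'k)" "L0 \<subseteq> L'"
      "\<forall>a\<in>L0. f' a = f0 a" "\<forall>i<j. unit_exp i 1 \<in> L'" by blast
    obtain L2 f2 where 2: "subgrp L2" "char_on L2 (f2 :: _ \<Rightarrow> 'k)" "L' \<subseteq> L2" "unit_exp j 1 \<in> L2"
        "\<And>a. a \<in> L' \<Longrightarrow> f2 a = f' a"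
      by (rule char_extend[OF 1(1,2), of "unit_exp j"]) (auto simp: unit_exp_def)
    have "\<forall>i<Suc j. unit_exp i 1 \<in> L2" using 1 2 by (auto simp: less_Suc_eq)
    moreover have "L0 \<subseteq> L2" "\<forall>a\<in>L0. f2 a = f0 a" using 1(3,4) 2(3,5) by auto
    ultimately show ?case using 2(1,2) by (intro exI[of _ L2] exI[of _ f2]) simp
  qed
  then obtain L' and f :: "(nat \<Rightarrow> int) \<Rightarrow> 'k" where
    1: "subgrp L'" "char_on L' f" "L0 \<subseteq> L'" "\<forall>a\<in>L0. f a = f0 a" "\<forall>i<k. unit_exp i 1 \<in> L'"
    by blast
  define v where "v = torus_pt k (\<lambda>i. f (unit_exp i 1))"
  have v: "v \<in> torus_pts k" unfolding v_def using 1(2,5) by (intro torus_pt_mem) (auto simp: char_on_def)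
  have tmon: "tmon k a v = f a" if a: "a \<in> exps k" for a
  proof -
    have "(\<lambda>i. if i < j then a i else 0) \<in> L' \<and>
        f (\<lambda>i. if i < j then a i else 0) = (\<Prod>i<j. f (unit_exp i 1) powi a i)" if "j \<le> k" for j
      using that
    proof (induction j)
      case 0
      then show ?case using subgrpD(1)[OF 1(1)] char_onD(1)[OF 1(1,2)] by (simp add: zero_fun_def)
    next
      case (Suc j)
      have e: "(\<lambda>i. if i < Suc j then a i else 0) = (\<lambda>i. if i < j then a i else 0) + unit_exp j (a j)"
        by (auto simp: fun_eq_iff unit_exp_def)
      have u: "unit_exp j (a j) \<in> L' \<and> f (unit_exp j (a j)) = f (unit_exp j 1) powi a j"
        using char_on_powi[OF 1(1,2), of "unit_exp j" 1 "a j"] 1(5) Suc.prems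
        by (auto simp: unit_exp_def fun_eq_iff)
      have "f ((\<lambda>i. if i < j then a i else 0) + unit_exp j (a j))
          = f (\<lambda>i. if i < j then a i else 0) * f (unit_exp j (a j))"
        using 1(2) u Suc unfolding char_on_def by (meson Suc_leD)
      then show ?case unfolding e using subgrpD(4)[OF 1(1)] u Suc by simp
    qed
    from this[of k] have "f (\<lambda>i. if i < k then a i else 0) = (\<Prod>i<k. f (unit_exp i 1) powi a i)" by simp
    moreover have "(\<lambda>i. if i < k then a i else 0) = a" using a by (auto simp: exps_def)
    ultimately show ?thesis by (simp add: v_def tmon_torus_pt)
  qed
  have "tmon k a v = 1" if "a \<in> L" for a
  proof -
    have "a \<in> exps k" "a \<in> L0" using that L(2) 0(3) by auto
    then show ?thesis using tmon 0(4)[OF that] 1(4) by simp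
  qed
  then have "v = \<one>\<^bsub>torus k\<^esub>" using triv v by blast
  then have "tmon k b v = 1" by (simp add: tmon_def torus_one_def)
  then show False using tmon[OF b(1)] 0(5,6) 1(4) by simp
qed

section \<open>Weights of a faithful torus action\<close>

locale torus_action =
  fixes k n :: nat and X :: "'k::{alg_closed_field, field_char_0} vec set"
    and \<tau> :: "'k vec \<Rightarrow> 'k vec \<Rightarrow> 'k vec"
  assumes X_carrier: "X \<subseteq> carrier_vec n"
    and bij: "v \<in> torus_pts k \<Longrightarrow> \<tau> v \<in> Bij X"
    and act_mult: "v \<in> torus_pts k \<Longrightarrow> w \<in> torus_pts k \<Longrightarrow> x \<in> X \<Longrightarrow> \<tau> (v \<otimes>\<^bsub>torus k\<^esub> w) x = \<tau> v (\<tau> w x)"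
    and faithful: "inj_on \<tau> (torus_pts k)"
    and regular: "i < n \<Longrightarrow> \<exists>p\<in>poly_funs (2 * k + n). \<forall>v\<in>torus_pts k. \<forall>x\<in>X. \<tau> v x $ i = p (v @\<^sub>v x)"
begin

lemma act_closed: "v \<in> torus_pts k \<Longrightarrow> x \<in> X \<Longrightarrow> \<tau> v x \<in> X"
  using bij Bij_imp_funcset by blast

lemma act_inj: "v \<in> torus_pts k \<Longrightarrow> x \<in> X \<Longrightarrow> y \<in> X \<Longrightarrow> \<tau> v x = \<tau> v y \<Longrightarrow> x = y"
  using bij[of v] by (auto simp: Bij_def bij_betw_def inj_on_def)

lemma act_one: 
  assumes x: "x \<in> X"
  shows "\<tau> \<one>\<^bsub>torus k\<^esub> x = x"
  using act_mult[OF torus_one_closed torus_one_closed x] torus_mult_one[OF torus_one_closed, of k, where ?'a = 'k]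
    act_inj[OF torus_one_closed] act_closed[OF torus_one_closed] x by simp

lemma act_eqI:
  assumes v: "v \<in> torus_pts k" and w: "w \<in> torus_pts k" and eq: "\<And>x. x \<in> X \<Longrightarrow> \<tau> v x = \<tau> w x"
  shows "v = w"
proof -
  have "\<tau> v = \<tau> w"
    using bij[OF v] bij[OF w] eq by (intro extensionalityI[of _ X]) (auto simp: Bij_def)
  then show ?thesis using faithful v w by (auto simp: inj_on_def)
qed

definition weight_fun :: "(nat \<Rightarrow> int) \<Rightarrow> ('k vec \<Rightarrow> 'k) \<Rightarrow> bool" where
  "weight_fun a q \<longleftrightarrow> q \<in> poly_funs n \<and> (\<forall>v\<in>torus_pts k. \<forall>x\<in>X. q (\<tau> v x) = tmon k a v * q x)"

text \<open>
  The coefficients of the Laurent expansion of \<open>p (\<tau> v x)\<close> are weight functions: expanding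
  \<open>p (\<tau> v (\<tau> w x))\<close> in two ways and comparing coefficients of the monomials in \<open>v\<close> gives their
  transformation rule.
\<close>

lemma weight_decomposition:
  assumes "p \<in> poly_funs n"
  shows "\<exists>S q. finite S \<and> S \<subseteq> exps k \<and> (\<forall>a\<in>S. weight_fun a (q a)) \<and>
    (\<forall>v\<in>torus_pts k. \<forall>x\<in>X. p (\<tau> v x) = (\<Sum>a\<in>S. tmon k a v * q a x))"
proof -
  define V where "V = {v @\<^sub>v x | v x. v \<in> torus_pts k \<and> x \<in> X}"
  have dim: "v \<in> carrier_vec (2 * k)" if "v \<in> torus_pts k" for v :: "'k vec"
    using that by (simp add: torus_pts_iff)
  have split: "vec_first (v @\<^sub>v x) (2 * k) = v" "vec_last (v @\<^sub>v x) n = x" if "v \<in> torus_pts k" "x \<in> X" for v x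
    using dim[OF that(1)] that(2) X_carrier by (auto simp: vec_first_def vec_last_def intro!: eq_vecI)
  have "\<exists>q\<in>poly_funs (2 * k + n). \<forall>z\<in>V. \<tau> (vec_first z (2 * k)) (vec_last z n) $ i = q z" if i: "i < n" for i
  proof -
    obtain p where p: "p \<in> poly_funs (2 * k + n)" "\<forall>v\<in>torus_pts k. \<forall>x\<in>X. \<tau> v x $ i = p (v @\<^sub>v x)"
      using regular[OF i] by blast
    have "\<tau> (vec_first z (2 * k)) (vec_last z n) $ i = p z" if "z \<in> V" for z
    proof -
      obtain v x where z: "v \<in> torus_pts k" "x \<in> X" "z = v @\<^sub>v x"
        using \<open>z \<in> V\<close> unfolding V_def by blast
      show ?thesis unfolding z(3) split[OF z(1,2)] using p(2) z(1,2) by blast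
    qed
    then show ?thesis using p(1) by blast
  qed
  from poly_funs_comp[OF assms this]
  obtain P where P: "P \<in> poly_funs (2 * k + n)"
    "\<forall>z\<in>V. p (\<tau> (vec_first z (2 * k)) (vec_last z n)) = P z" by blast
  have P': "p (\<tau> v x) = P (v @\<^sub>v x)" if "v \<in> torus_pts k" "x \<in> X" for v x
  proof -
    have "v @\<^sub>v x \<in> V" using that by (auto simp: V_def)
    then show ?thesis using P(2) split[OF that] by metis
  qed
  obtain S q where S: "finite S" "S \<subseteq> exps k" "\<forall>a. q a \<in> poly_funs n"
    "\<forall>v\<in>torus_pts k. \<forall>x\<in>carrier_vec n. P (v @\<^sub>v x) = (\<Sum>a\<in>S. tmon k a v * q a x)"
    using laurent_expansion[OF P(1)] by blast
  have exp: "p (\<tau> v x) = (\<Sum>a\<in>S. tmon k a v * q a x)" if "v \<in> torus_pts k" "x \<in> X" for v x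
    unfolding P'[OF that] using S(4) that X_carrier by blast
  have "q a (\<tau> w x) = tmon k a w * q a x" if a: "a \<in> S" and w: "w \<in> torus_pts k" and x: "x \<in> X" for a w x
  proof -
    have "q a (\<tau> w x) - tmon k a w * q a x = 0"
    proof (rule tmon_independent[OF S(1,2) _ a, of "\<lambda>a. q a (\<tau> w x) - tmon k a w * q a x"])
      fix v :: "'k vec" assume v: "v \<in> torus_pts k"
      have "(\<Sum>a\<in>S. tmon k a v * q a (\<tau> w x)) = p (\<tau> v (\<tau> w x))"
        using exp[OF v act_closed[OF w x]] by simp
      also have "\<dots> = p (\<tau> (v \<otimes>\<^bsub>torus k\<^esub> w) x)" using act_mult[OF v w x] by simp
      also have "\<dots> = (\<Sum>a\<in>S. tmon k a v * (tmon k a w * q a x))"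
        using exp[OF torus_mult_closed[OF v w] x] by (simp add: tmon_mult mult.assoc)
      finally show "(\<Sum>a\<in>S. (q a (\<tau> w x) - tmon k a w * q a x) * tmon k a v) = 0"
        by (simp add: algebra_simps sum_subtractf)
    qed
    then show ?thesis by simp
  qed
  then show ?thesis using S(1-3) exp by (intro exI[of _ S] exI[of _ q]) (auto simp: weight_fun_def)
qed

definition weights :: "(nat \<Rightarrow> int) set" where
  "weights = {a \<in> exps k. \<exists>q. weight_fun a q \<and> (\<exists>x\<in>X. q x \<noteq> 0)}"

text \<open>
  The coordinate functions are sums of weight functions, so a point of the torus that every weight
  sends to 1 moves no point of \<open>X\<close>.
\<close>

lemma weights_faithful:
  fixes v :: "'k vec"
  assumes v: "v \<in> torus_pts k" and one: "\<And>a. a \<in> weights \<Longrightarrow> tmon k a v = 1"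
  shows "v = \<one>\<^bsub>torus k\<^esub>"
proof (rule act_eqI[OF v torus_one_closed])
  fix x assume x: "x \<in> X"
  have "\<tau> v x $ i = x $ i" if i: "i < n" for i
  proof -
    obtain S q where S: "finite S" "S \<subseteq> exps k" "\<forall>a\<in>S. weight_fun a (q a)"
      "\<forall>v\<in>torus_pts k. \<forall>x\<in>X. \<tau> v x $ i = (\<Sum>a\<in>S. tmon k a v * q a x)"
      using weight_decomposition[OF poly_funs.coord[OF i]] by blast
    have "tmon k a v * q a x = tmon k a \<one>\<^bsub>torus k\<^esub> * q a x" if a: "a \<in> S" for a
    proof (cases "q a x = 0")
      case False
      then have "a \<in> weights" using S(2,3) a x by (auto simp: weights_def)
      then show ?thesis using one by (simp add: tmon_def torus_one_def)
    qed simp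
    then have "\<tau> v x $ i = \<tau> \<one>\<^bsub>torus k\<^esub> x $ i"
      using S(4) v torus_one_closed x by (metis (no_types, lifting) sum.cong)
    then show ?thesis using act_one[OF x] by simp
  qed
  moreover have "\<tau> v x \<in> carrier_vec n" "x \<in> carrier_vec n"
    using act_closed[OF v x] x X_carrier by auto
  ultimately have "\<tau> v x = x" by (intro eq_vecI) auto
  then show "\<tau> v x = \<tau> \<one>\<^bsub>torus k\<^esub> x" using act_one[OF x] by simp
qed

text \<open>
  If \<open>q\<close> has weight \<open>a\<close>, then along an orbit \<open>q \<circ> g\<close> varies by the factor \<open>tmon k a (c v)\<close>. This
  factor is therefore a regular function of \<open>v\<close>; being multiplicative, it is a monomial. It is here
  that an abstract automorphism \<open>c\<close> of the torus is recognised as algebraic.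
\<close>

lemma normalizing_weight:
  assumes g: "g ` X = X" "\<And>i. i < n \<Longrightarrow> \<exists>p\<in>poly_funs n. \<forall>x\<in>X. g x $ i = p x"
    and c: "\<And>v. v \<in> torus_pts k \<Longrightarrow> c v \<in> torus_pts k"
      "\<And>v w. v \<in> torus_pts k \<Longrightarrow> w \<in> torus_pts k \<Longrightarrow> c (v \<otimes>\<^bsub>torus k\<^esub> w) = c v \<otimes>\<^bsub>torus k\<^esub> c w"
      "\<And>v x. v \<in> torus_pts k \<Longrightarrow> x \<in> X \<Longrightarrow> g (\<tau> v x) = \<tau> (c v) (g x)"
    and a: "a \<in> weights"
  shows "\<exists>b\<in>exps k. \<forall>v\<in>torus_pts k. tmon k a (c v) = tmon k b v"
proof -
  obtain q y where q: "weight_fun a q" "y \<in> X" "q y \<noteq> 0" using a by (auto simp: weights_def)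
  then obtain x where x: "x \<in> X" "y = g x" using g(1) by blast
  obtain p where p: "p \<in> poly_funs n" "\<forall>x\<in>X. q (g x) = p x"
    using poly_funs_comp[of q n n X g] q(1) g(2) by (auto simp: weight_fun_def)
  obtain S r where S: "finite S" "S \<subseteq> exps k"
    "\<forall>v\<in>torus_pts k. \<forall>x\<in>X. p (\<tau> v x) = (\<Sum>a\<in>S. tmon k a v * r a x)"
    using weight_decomposition[OF p(1)] by blast
  have expand: "tmon k a (c v) = (\<Sum>b\<in>S. (r b x / q y) * tmon k b v)" if v: "v \<in> torus_pts k" for v
  proof -
    have "(\<Sum>b\<in>S. tmon k b v * r b x) = q (g (\<tau> v x))"
      using S(3) p(2) v x act_closed by auto
    also have "\<dots> = tmon k a (c v) * q y"
      using c(1,3)[OF v] x q(1,2) by (auto simp: weight_fun_def)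
    finally have "tmon k a (c v) = (\<Sum>b\<in>S. tmon k b v * r b x) / q y"
      using q(3) by (simp add: field_simps)
    then show ?thesis by (simp add: sum_divide_distrib mult.commute)
  qed
  have "\<exists>b\<in>S. \<forall>v\<in>torus_pts k. tmon k a (c v) = tmon k b v"
  proof (rule regular_character_is_tmon[OF S(1,2)])
    show "tmon k a (c (v \<otimes>\<^bsub>torus k\<^esub> w)) = tmon k a (c v) * tmon k a (c w)"
      if "v \<in> torus_pts k" "w \<in> torus_pts k" for v w using c(2)[OF that] by (simp add: tmon_mult)
    show "tmon k a (c v) \<noteq> 0" if "v \<in> torus_pts k" for v using c(1)[OF that] by (rule tmon_nz)
  qed (rule expand)
  then show ?thesis using S(2) by blast
qed

text \<open>
  The exponents that \<open>c\<close> pulls back to monomials form a subgroup containing all weights, and by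
  faithfulness of the action such a subgroup is the whole lattice.
\<close>

lemma normalizing_monomial:
  assumes g: "g ` X = X" "\<And>i. i < n \<Longrightarrow> \<exists>p\<in>poly_funs n. \<forall>x\<in>X. g x $ i = p x"
    and c: "\<And>v. v \<in> torus_pts k \<Longrightarrow> c v \<in> torus_pts k"
      "\<And>v w. v \<in> torus_pts k \<Longrightarrow> w \<in> torus_pts k \<Longrightarrow> c (v \<otimes>\<^bsub>torus k\<^esub> w) = c v \<otimes>\<^bsub>torus k\<^esub> c w"
      "\<And>v x. v \<in> torus_pts k \<Longrightarrow> x \<in> X \<Longrightarrow> g (\<tau> v x) = \<tau> (c v) (g x)"
    and a: "a \<in> exps k"
  shows "\<exists>b\<in>exps k. \<forall>v\<in>torus_pts k. tmon k a (c v) = tmon k b v"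
proof -
  define L where "L = {a \<in> exps k. \<exists>b\<in>exps k. \<forall>v\<in>torus_pts k. tmon k a (c v) = tmon k b v}"
  have "subgrp L" unfolding subgrp_def
  proof (intro conjI ballI)
    show "0 \<in> L" using subgrpD(1)[OF exps_subgrp] unfolding L_def
      by (auto simp: tmon_zero intro!: bexI[of _ 0])
    fix a a' assume "a \<in> L" "a' \<in> L"
    then obtain b b' where "a \<in> exps k" "a' \<in> exps k" "b \<in> exps k" "b' \<in> exps k"
      "\<forall>v\<in>torus_pts k. tmon k a (c v) = tmon k b v" "\<forall>v\<in>torus_pts k. tmon k a' (c v) = tmon k b' v"
      unfolding L_def by blast
    then show "a - a' \<in> L" unfolding L_def
      using subgrpD(2)[OF exps_subgrp] c(1) by (auto simp: tmon_diff intro!: bexI[of _ "b - b'"])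
  qed
  moreover have "L \<subseteq> exps k" by (auto simp: L_def)
  moreover have "weights \<subseteq> L"
    using normalizing_weight[OF g c] by (auto simp: L_def weights_def)
  then have "v = \<one>\<^bsub>torus k\<^esub>" if "v \<in> torus_pts k" "\<And>a. a \<in> L \<Longrightarrow> tmon k a v = 1" for v :: "'k vec"
    using weights_faithful that by blast
  ultimately have "L = exps k" using subgrp_exps_full by blast
  then show ?thesis using a by (auto simp: L_def)
qed

end

section \<open>The dimension of a torus\<close>

text \<open>
  It suffices that the restrictions of polynomial functions to \<open>V\<close> have no zero divisors.
\<close>

lemma irreducible_closedI:
  assumes "zariski_closed n V" "V \<noteq> {}"
    and int: "\<And>f g. f \<in> poly_funs n \<Longrightarrow> g \<in> poly_funs n \<Longrightarrow> \<exists>x\<in>V. f x \<noteq> 0 \<Longrightarrow> \<exists>x\<in>V. g x \<noteq> 0 \<Longrightarrow>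
      \<exists>x\<in>V. f x \<noteq> (0 :: 'k::comm_ring_1) \<and> g x \<noteq> 0"
  shows "irreducible_closed n V"
  unfolding irreducible_closed_def
proof (intro conjI allI impI assms(1,2))
  fix A B assume A: "zariski_closed n A" and B: "zariski_closed n B" and V: "V = A \<union> B"
  have sub: "V \<subseteq> carrier_vec n" using assms(1) by (auto simp: zariski_closed_def)
  have sep: "\<exists>f\<in>poly_funs n. (\<exists>x\<in>V. f x \<noteq> 0) \<and> (\<forall>x\<in>C. f x = 0)"
    if C: "zariski_closed n C" "C \<subseteq> V" "V \<noteq> C" for C
  proof -
    obtain F where F: "F \<subseteq> poly_funs n" "C = {x \<in> carrier_vec n. \<forall>f\<in>F. f x = 0}"
      using C(1) by (auto simp: zariski_closed_def)
    obtain x where x: "x \<in> V" "x \<notin> C" using C by blast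
    then obtain f where "f \<in> F" "f x \<noteq> 0" using F(2) sub by blast
    then show ?thesis using F x by auto
  qed
  show "V = A \<or> V = B"
  proof (rule ccontr)
    assume "\<not> ?thesis"
    then obtain f g where "f \<in> poly_funs n" "\<exists>x\<in>V. f x \<noteq> 0" "\<forall>x\<in>A. f x = 0"
      "g \<in> poly_funs n" "\<exists>x\<in>V. g x \<noteq> 0" "\<forall>x\<in>B. g x = 0"
      using sep[OF A] sep[OF B] V by auto
    then show False using int[of f g] V by blast
  qed
qed

text \<open>
  Two points of the torus are joined by the segment between their parameters, with finitely many
  values of \<open>t\<close> removed. Along this curve a regular function becomes a rational function whose
  denominator is a power of the product \<open>Q\<close> of the parameters.
\<close>

lemma poly_fun_along_line:
  fixes u w :: "nat \<Rightarrow> 'k::field" and k :: nat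
  defines "Q \<equiv> (\<Prod>j<k. [:u j, w j - u j:])"
    and "\<gamma> \<equiv> (\<lambda>t. torus_pt k (\<lambda>j. u j + t * (w j - u j)))"
  assumes "p \<in> poly_funs (2 * k)"
  shows "\<exists>P N. \<forall>t. poly Q t \<noteq> 0 \<longrightarrow> p (\<gamma> t) * poly Q t ^ N = poly P t"
  using assms(3)
proof induction
  case (const c)
  show ?case by (intro exI[of _ "[:c:]"] exI[of _ 0]) simp
next
  case (coord i)
  have k: "i div 2 < k" using coord by auto
  let ?l = "\<lambda>j. [:u j, w j - u j:]"
  have Q: "Q = ?l (i div 2) * (\<Prod>j\<in>{..<k} - {i div 2}. ?l j)"
    unfolding Q_def using k by (intro prod.remove) auto
  show ?case
  proof (cases "even i")
    case True
    then have "\<gamma> t $ i = poly (?l (i div 2)) t" for t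
      using coord by (simp add: \<gamma>_def torus_pt_def)
    then show ?thesis by (intro exI[of _ "?l (i div 2)"] exI[of _ 0]) simp
  next
    case False
    then have "\<gamma> t $ i = inverse (poly (?l (i div 2)) t)" for t
      using coord by (simp add: \<gamma>_def torus_pt_def)
    moreover have "poly (?l (i div 2)) t \<noteq> 0" if "poly Q t \<noteq> 0" for t
      using that unfolding Q poly_mult by auto
    ultimately have "\<gamma> t $ i * poly Q t ^ 1 = poly (\<Prod>j\<in>{..<k} - {i div 2}. ?l j) t" if "poly Q t \<noteq> 0" for t
      using that unfolding Q poly_mult by (simp del: poly_pCons)
    then show ?thesis by blast
  qed
next
  case (add p q)
  then obtain P N P' N' where
    "\<forall>t. poly Q t \<noteq> 0 \<longrightarrow> p (\<gamma> t) * poly Q t ^ N = poly P t"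
    "\<forall>t. poly Q t \<noteq> 0 \<longrightarrow> q (\<gamma> t) * poly Q t ^ N' = poly P' t" by blast
  then have "(p (\<gamma> t) + q (\<gamma> t)) * poly Q t ^ (N + N') = poly (P * Q ^ N' + P' * Q ^ N) t"
    if "poly Q t \<noteq> 0" for t
    using that[THEN \<open>\<forall>t. poly Q t \<noteq> 0 \<longrightarrow> p (\<gamma> t) * poly Q t ^ N = poly P t\<close>[rule_format, symmetric]]
      that[THEN \<open>\<forall>t. poly Q t \<noteq> 0 \<longrightarrow> q (\<gamma> t) * poly Q t ^ N' = poly P' t\<close>[rule_format, symmetric]]
    by (simp add: poly_power power_add algebra_simps)
  then show ?case by blast
next
  case (mult p q)
  then obtain P N P' N' where
    "\<forall>t. poly Q t \<noteq> 0 \<longrightarrow> p (\<gamma> t) * poly Q t ^ N = poly P t"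
    "\<forall>t. poly Q t \<noteq> 0 \<longrightarrow> q (\<gamma> t) * poly Q t ^ N' = poly P' t" by blast
  then have "(p (\<gamma> t) * q (\<gamma> t)) * poly Q t ^ (N + N') = poly (P * P') t"
    if "poly Q t \<noteq> 0" for t
    using that[THEN \<open>\<forall>t. poly Q t \<noteq> 0 \<longrightarrow> p (\<gamma> t) * poly Q t ^ N = poly P t\<close>[rule_format, symmetric]]
      that[THEN \<open>\<forall>t. poly Q t \<noteq> 0 \<longrightarrow> q (\<gamma> t) * poly Q t ^ N' = poly P' t\<close>[rule_format, symmetric]]
    by (simp add: poly_power power_add algebra_simps)
  then show ?case by blast
qed

text \<open>
  The subgroups on which the parameters from \<open>i\<close> on are 1 form a chain of length \<open>k\<close>. They are
  irreducible: if \<open>f\<close> does not vanish at \<open>x\<close> and \<open>g\<close> does not vanish at \<open>y\<close>, then on the punctured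
  segment from \<open>x\<close> to \<open>y\<close> both have finitely many zeros, so some point of it is a zero of neither.
\<close>

lemma torus_dim_ge:
  fixes H :: "'k::field_char_0 vec monoid"
  assumes H: "affine_alg_group m H" and iso: "alg_group_iso m H (2 * k) (torus k)"
  shows "enat k \<le> variety_dim m (carrier H)"
proof -
  obtain \<psi> where \<psi>: "\<psi> \<in> iso H (torus k)" "morphism m (carrier H) (2 * k) (torus_pts k) \<psi>"
    and inv: "morphism (2 * k) (torus_pts k) m (carrier H) (inv_into (carrier H) \<psi>)"
    using iso by (auto simp: alg_group_iso_def)
  define \<phi> where "\<phi> = inv_into (carrier H) \<psi>"
  have bb: "bij_betw \<psi> (carrier H) (torus_pts k)" using \<psi>(1) by (simp add: iso_def)
  have \<phi>_mem: "\<phi> v \<in> carrier H" and \<psi>\<phi>: "\<psi> (\<phi> v) = v" if "v \<in> torus_pts k" for v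
    using bb that unfolding \<phi>_def by (auto simp: bij_betw_def inv_into_into f_inv_into_f)
  have \<psi>_mem: "\<psi> h \<in> torus_pts k" and \<phi>\<psi>: "\<phi> (\<psi> h) = h" if "h \<in> carrier H" for h
    using bb that unfolding \<phi>_def by (auto simp: bij_betw_def)
  define Z where "Z i = {h \<in> carrier H. \<forall>j. i \<le> j \<longrightarrow> j < k \<longrightarrow> \<psi> h $ (2 * j) = 1}" for i
  have closed: "zariski_closed m (Z i)" for i
  proof -
    obtain F where F: "F \<subseteq> poly_funs m" "carrier H = {x \<in> carrier_vec m. \<forall>f\<in>F. f x = 0}"
      using H by (auto simp: affine_alg_group_def zariski_closed_def)
    have "\<forall>j\<in>{..<k}. \<exists>p. p \<in> poly_funs m \<and> (\<forall>x\<in>carrier H. \<psi> x $ (2 * j) = p x)"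
    proof
      fix j assume "j \<in> {..<k}"
      then have "2 * j < 2 * k" by simp
      then show "\<exists>p. p \<in> poly_funs m \<and> (\<forall>x\<in>carrier H. \<psi> x $ (2 * j) = p x)"
        using \<psi>(2) unfolding morphism_def by blast
    qed
    then obtain p where p: "\<And>j. j < k \<Longrightarrow> p j \<in> poly_funs m"
      "\<And>j x. j < k \<Longrightarrow> x \<in> carrier H \<Longrightarrow> \<psi> x $ (2 * j) = p j x"
      unfolding bchoice_iff by auto
    define F' where "F' = F \<union> {(\<lambda>x. p j x + (-1)) | j. i \<le> j \<and> j < k}"
    have "(\<lambda>x. p j x + (-1)) \<in> poly_funs m" if "j < k" for j
      using p(1)[OF that] by (intro poly_funs.add poly_funs.const)
    then have "F' \<subseteq> poly_funs m" using F(1) unfolding F'_def by blast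
    moreover have "Z i = {x \<in> carrier_vec m. \<forall>f\<in>F'. f x = 0}"
    proof -
      have "x \<in> Z i \<longleftrightarrow> x \<in> carrier H \<and> (\<forall>j. i \<le> j \<longrightarrow> j < k \<longrightarrow> p j x + (-1) = 0)" for x
        unfolding Z_def using p(2) by auto
      moreover have "x \<in> carrier H \<longleftrightarrow> x \<in> carrier_vec m \<and> (\<forall>f\<in>F. f x = 0)" for x
        by (subst F(2)) simp
      moreover have "(\<forall>f\<in>F'. f x = 0) \<longleftrightarrow> (\<forall>f\<in>F. f x = 0) \<and> (\<forall>j. i \<le> j \<longrightarrow> j < k \<longrightarrow> p j x + (-1) = 0)" for x
        unfolding F'_def by (auto simp del: add_uminus_conv_diff)
      ultimately show ?thesis by auto
    qed
    ultimately show ?thesis unfolding zariski_closed_def by blast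
  qed
  have irred: "irreducible_closed m (Z i)" for i
  proof (rule irreducible_closedI[OF closed])
    have "torus_pt k (\<lambda>_. 1 :: 'k) \<in> torus_pts k" by (rule torus_pt_mem) simp
    then have "\<phi> (torus_pt k (\<lambda>_. 1)) \<in> Z i"
      by (simp add: Z_def \<phi>_mem \<psi>\<phi> torus_pt_coord)
    then show "Z i \<noteq> {}" by blast
    fix f g :: "'k vec \<Rightarrow> 'k"
    assume f: "f \<in> poly_funs m" and g: "g \<in> poly_funs m"
      and "\<exists>x\<in>Z i. f x \<noteq> 0" "\<exists>x\<in>Z i. g x \<noteq> 0"
    then obtain x y where x: "x \<in> Z i" "f x \<noteq> 0" and y: "y \<in> Z i" "g y \<noteq> 0" by blast
    define u where "u j = \<psi> x $ (2 * j)" for j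
    define w where "w j = \<psi> y $ (2 * j)" for j
    have xy: "\<psi> x \<in> torus_pts k" "\<psi> y \<in> torus_pts k" using x y \<psi>_mem by (auto simp: Z_def)
    define \<gamma> where "\<gamma> t = torus_pt k (\<lambda>j. u j + t * (w j - u j))" for t
    define Q where "Q = (\<Prod>j<k. [:u j, w j - u j:])"
    have \<gamma>: "\<gamma> t \<in> torus_pts k" if "poly Q t \<noteq> 0" for t
      using that unfolding \<gamma>_def Q_def by (intro torus_pt_mem) (auto simp: poly_prod)
    have Z\<gamma>: "\<phi> (\<gamma> t) \<in> Z i" if "poly Q t \<noteq> 0" for t
      using x(1) y(1) \<phi>_mem[OF \<gamma>[OF that]] \<psi>\<phi>[OF \<gamma>[OF that]]
      by (auto simp: Z_def \<gamma>_def torus_pt_coord u_def w_def)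
    have Q01: "poly Q 0 \<noteq> 0" "poly Q 1 \<noteq> 0"
      using xy by (auto simp: Q_def poly_prod u_def w_def dest: torus_coord_nz)
    have "\<gamma> 0 = \<psi> x"
      by (rule torus_eqI[OF \<gamma>[OF Q01(1)] xy(1)]) (simp add: \<gamma>_def torus_pt_coord u_def)
    moreover have "\<gamma> 1 = \<psi> y"
      by (rule torus_eqI[OF \<gamma>[OF Q01(2)] xy(2)]) (simp add: \<gamma>_def torus_pt_coord u_def w_def)
    ultimately have ends: "\<phi> (\<gamma> 0) = x" "\<phi> (\<gamma> 1) = y" using \<phi>\<psi> x y by (auto simp: Z_def)
    have pull: "\<exists>P N. \<forall>t. poly Q t \<noteq> 0 \<longrightarrow> f (\<phi> (\<gamma> t)) * poly Q t ^ N = poly P t"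
      if pf: "f \<in> poly_funs m" for f
    proof -
      obtain p where p: "p \<in> poly_funs (2 * k)" "\<forall>v\<in>torus_pts k. f (\<phi> v) = p v"
        using poly_funs_comp[OF pf, of "2 * k" "torus_pts k" \<phi>] inv by (auto simp: morphism_def \<phi>_def)
      show ?thesis using poly_fun_along_line[OF p(1), of u w] p(2) \<gamma> unfolding \<gamma>_def Q_def by simp
    qed
    obtain P N where P: "\<forall>t. poly Q t \<noteq> 0 \<longrightarrow> f (\<phi> (\<gamma> t)) * poly Q t ^ N = poly P t"
      using pull[OF f] by blast
    obtain R M where R: "\<forall>t. poly Q t \<noteq> 0 \<longrightarrow> g (\<phi> (\<gamma> t)) * poly Q t ^ M = poly R t"
      using pull[OF g] by blast
    have "poly P 0 \<noteq> 0" using P[rule_format, OF Q01(1)] ends x Q01 by auto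
    moreover have "poly R 1 \<noteq> 0" using R[rule_format, OF Q01(2)] ends y Q01 by auto
    ultimately have "P * R * Q \<noteq> 0" using Q01 by auto
    then have "finite {t. poly (P * R * Q) t = 0}" by (rule poly_roots_finite)
    then have "{t. poly (P * R * Q) t = 0} \<noteq> UNIV" using infinite_UNIV_char_0[where ?'a = 'k] by metis
    then obtain t where t: "poly (P * R * Q) t \<noteq> 0" by blast
    then have Qt: "poly Q t \<noteq> 0" by auto
    have "f (\<phi> (\<gamma> t)) \<noteq> 0" "g (\<phi> (\<gamma> t)) \<noteq> 0"
      using P[rule_format, OF Qt] R[rule_format, OF Qt] t by auto
    then show "\<exists>x\<in>Z i. f x \<noteq> 0 \<and> g x \<noteq> 0" using Z\<gamma>[OF Qt] by blast
  qed
  have "Z i \<subset> Z (Suc i)" if i: "i < k" for i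
  proof
    show "Z i \<subseteq> Z (Suc i)" by (auto simp: Z_def)
    define v :: "'k vec" where "v = torus_pt k (\<lambda>j. if j = i then 2 else 1)"
    have v: "v \<in> torus_pts k" unfolding v_def by (rule torus_pt_mem) auto
    have "\<phi> v \<in> Z (Suc i)" "\<phi> v \<notin> Z i"
      using \<phi>_mem[OF v] \<psi>\<phi>[OF v] i by (auto simp: Z_def v_def torus_pt_coord)
    then show "Z i \<noteq> Z (Suc i)" by blast
  qed
  then have "irreducible_chain m (carrier H) k Z"
    using irred by (auto simp: irreducible_chain_def Z_def)
  then show ?thesis unfolding variety_dim_def by (intro SUP_upper) blast
qed

section \<open>Monomial maps\<close>

definition monomial_map :: "nat \<Rightarrow> int mat \<Rightarrow> 'k::field vec \<Rightarrow> 'k vec" where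
  "monomial_map k A v = torus_pt k (\<lambda>i. tmon k (\<lambda>j. A $$ (i, j)) v)"

lemma monomial_map_mem: "v \<in> torus_pts k \<Longrightarrow> monomial_map k A v \<in> torus_pts k"
  unfolding monomial_map_def by (intro torus_pt_mem tmon_nz)

lemma monomial_map_coord: "i < k \<Longrightarrow> monomial_map k A v $ (2 * i) = tmon k (\<lambda>j. A $$ (i, j)) v"
  unfolding monomial_map_def by (rule torus_pt_coord)

lemma monomial_map_one:
  assumes v: "v \<in> torus_pts k"
  shows "monomial_map k (1\<^sub>m k) v = v"
proof (rule torus_eqI[OF monomial_map_mem[OF v] v])
  fix i assume i: "i < k"
  have "tmon k (\<lambda>j. 1\<^sub>m k $$ (i, j)) v = tmon k (unit_exp i 1) v"
    using i unfolding tmon_def unit_exp_def by (intro prod.cong) auto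
  then show "monomial_map k (1\<^sub>m k) v $ (2 * i) = v $ (2 * i)"
    using i by (simp add: monomial_map_coord tmon_unit)
qed

lemma prod_powi: "(\<Prod>j\<in>J. f j) powi (m::int) = (\<Prod>j\<in>J. (f j :: 'k::field) powi m)"
  by (induction J rule: infinite_finite_induct) (auto simp: power_int_mult_distrib)

lemma powi_sum: "(x :: 'k::field) \<noteq> 0 \<Longrightarrow> x powi (\<Sum>j\<in>J. f j) = (\<Prod>j\<in>J. x powi f j)"
  by (induction J rule: infinite_finite_induct) (auto simp: power_int_add)

lemma monomial_map_mult:
  assumes v: "v \<in> torus_pts k" and A: "A \<in> carrier_mat k k" and B: "B \<in> carrier_mat k k"
  shows "monomial_map k (A * B) v = monomial_map k A (monomial_map k B v)"
proof (rule torus_eqI[of _ k])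
  show "monomial_map k (A * B) v \<in> torus_pts k" "monomial_map k A (monomial_map k B v) \<in> torus_pts k"
    using v by (simp_all add: monomial_map_mem)
  fix i assume i: "i < k"
  have "monomial_map k A (monomial_map k B v) $ (2 * i)
      = (\<Prod>j<k. (\<Prod>l<k. v $ (2 * l) powi B $$ (j, l)) powi A $$ (i, j))"
    using i by (simp add: monomial_map_coord) (simp add: tmon_def monomial_map_coord)
  also have "\<dots> = (\<Prod>j<k. \<Prod>l<k. v $ (2 * l) powi (A $$ (i, j) * B $$ (j, l)))"
    unfolding prod_powi by (simp add: power_int_mult[symmetric] mult.commute)
  also have "\<dots> = (\<Prod>l<k. \<Prod>j<k. v $ (2 * l) powi (A $$ (i, j) * B $$ (j, l)))"
    by (rule prod.swap)
  also have "\<dots> = (\<Prod>l<k. v $ (2 * l) powi (\<Sum>j<k. A $$ (i, j) * B $$ (j, l)))"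
    using v by (intro prod.cong) (auto simp: powi_sum torus_coord_nz)
  also have "\<dots> = (\<Prod>l<k. v $ (2 * l) powi ((A * B) $$ (i, l)))"
    using A B i by (intro prod.cong) (auto simp: scalar_prod_def atLeast0LessThan)
  finally show "monomial_map k (A * B) v $ (2 * i) = monomial_map k A (monomial_map k B v) $ (2 * i)"
    using i by (simp add: monomial_map_coord tmon_def)
qed

lemma monomial_map_inj:
  assumes A: "A \<in> carrier_mat k k" and B: "B \<in> carrier_mat k k"
    and eq: "\<And>v :: 'k::field_char_0 vec. v \<in> torus_pts k \<Longrightarrow> monomial_map k A v = monomial_map k B v"
  shows "A = B"
proof (rule eq_matI)
  fix i j assume ij: "i < dim_row B" "j < dim_col B"
  define row where "row C = (\<lambda>j. if j < k then C $$ (i, j) else (0::int))" for C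
  have row: "tmon k (row C) v = tmon k (\<lambda>j. C $$ (i, j)) v" for C and v :: "'k vec"
    unfolding tmon_def row_def by (intro prod.cong) auto
  have "row A = row B"
  proof (rule ccontr)
    assume "row A \<noteq> row B"
    then obtain v :: "'k vec" where "v \<in> torus_pts k" "tmon k (row A) v \<noteq> tmon k (row B) v"
      using tmon_separate[of "row A" k "row B"] by (auto simp: exps_def row_def)
    then show False using eq[of v] ij B monomial_map_coord[of i k A v] monomial_map_coord[of i k B v]
      by (simp add: row)
  qed
  then show "A $$ (i, j) = B $$ (i, j)" using ij B by (auto simp: row_def dest: fun_cong[of _ _ j])
qed (use A B in auto)

text \<open>
  Row \<open>i\<close> of the matrix is the exponent to which the \<open>i\<close>-th parameter is pulled back.
\<close>

lemma (in torus_action) normalizing_monomial_map: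
  assumes g: "g ` X = X" "\<And>i. i < n \<Longrightarrow> \<exists>p\<in>poly_funs n. \<forall>x\<in>X. g x $ i = p x"
    and norm: "\<And>v. v \<in> torus_pts k \<Longrightarrow> \<exists>w\<in>torus_pts k. \<forall>x\<in>X. g (\<tau> v x) = \<tau> w (g x)"
  shows "\<exists>A\<in>carrier_mat k k. \<forall>v\<in>torus_pts k. \<forall>x\<in>X. g (\<tau> v x) = \<tau> (monomial_map k A v) (g x)"
proof -
  have "\<exists>c. \<forall>v\<in>torus_pts k. c v \<in> torus_pts k \<and> (\<forall>x\<in>X. g (\<tau> v x) = \<tau> (c v) (g x))"
    using norm by (intro bchoice) blast
  then obtain c where c: "\<And>v. v \<in> torus_pts k \<Longrightarrow> c v \<in> torus_pts k"
    "\<And>v x. v \<in> torus_pts k \<Longrightarrow> x \<in> X \<Longrightarrow> g (\<tau> v x) = \<tau> (c v) (g x)" by blast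
  have c_mult: "c (v \<otimes>\<^bsub>torus k\<^esub> w) = c v \<otimes>\<^bsub>torus k\<^esub> c w"
    if v: "v \<in> torus_pts k" and w: "w \<in> torus_pts k" for v w
  proof (rule act_eqI)
    show "c (v \<otimes>\<^bsub>torus k\<^esub> w) \<in> torus_pts k" "c v \<otimes>\<^bsub>torus k\<^esub> c w \<in> torus_pts k"
      using v w c(1) torus_mult_closed by blast+
    fix y assume "y \<in> X"
    then obtain x where x: "x \<in> X" "y = g x" using g(1) by blast
    have gx: "g x \<in> X" using g(1) x by blast
    have "\<tau> (c (v \<otimes>\<^bsub>torus k\<^esub> w)) (g x) = g (\<tau> v (\<tau> w x))"
      using c(2)[OF torus_mult_closed[OF v w] x(1)] act_mult[OF v w x(1)] by simp
    also have "\<dots> = \<tau> (c v) (\<tau> (c w) (g x))"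
      using c(2)[OF v act_closed[OF w x(1)]] c(2)[OF w x(1)] by simp
    also have "\<dots> = \<tau> (c v \<otimes>\<^bsub>torus k\<^esub> c w) (g x)"
      using act_mult[OF c(1)[OF v] c(1)[OF w] gx] by simp
    finally show "\<tau> (c (v \<otimes>\<^bsub>torus k\<^esub> w)) y = \<tau> (c v \<otimes>\<^bsub>torus k\<^esub> c w) y" using x(2) by simp
  qed
  have "\<forall>i\<in>{..<k}. \<exists>b. \<forall>v\<in>torus_pts k. c v $ (2 * i) = tmon k b v"
  proof
    fix i assume "i \<in> {..<k}"
    then have i: "i < k" by simp
    obtain b where "\<forall>v\<in>torus_pts k. tmon k (unit_exp i 1) (c v) = tmon k b v"
      using normalizing_monomial[OF g c(1) c_mult c(2) unit_exp_exps[OF i, of 1]] by blast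
    then show "\<exists>b. \<forall>v\<in>torus_pts k. c v $ (2 * i) = tmon k b v"
      by (auto simp: tmon_unit[OF i])
  qed
  then obtain b where b: "\<And>i v. i < k \<Longrightarrow> v \<in> torus_pts k \<Longrightarrow> c v $ (2 * i) = tmon k (b i) v"
    unfolding bchoice_iff by auto
  define A where "A = mat k k (\<lambda>(i, j). b i j)"
  have "c v = monomial_map k A v" if v: "v \<in> torus_pts k" for v
  proof (rule torus_eqI[OF c(1)[OF v] monomial_map_mem[OF v]])
    fix i assume i: "i < k"
    have "tmon k (\<lambda>j. A $$ (i, j)) v = tmon k (b i) v"
      using i unfolding tmon_def A_def by (intro prod.cong) auto
    then show "c v $ (2 * i) = monomial_map k A v $ (2 * i)"
      using b[OF i v] i by (simp add: monomial_map_coord)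
  qed
  then show ?thesis using c(2) by (intro bexI[of _ A]) (auto simp: A_def)
qed

section \<open>The automorphism group of a variety\<close>

lemma group_homI: "group G \<Longrightarrow> group H \<Longrightarrow> h \<in> hom G H \<Longrightarrow> group_hom G H h"
  by (simp add: group_hom_def group_hom_axioms_def)

lemma BijGroup_simps:
  "carrier (BijGroup X) = Bij X"
  "f \<in> Bij X \<Longrightarrow> g \<in> Bij X \<Longrightarrow> f \<otimes>\<^bsub>BijGroup X\<^esub> g = compose X f g"
  "\<one>\<^bsub>BijGroup X\<^esub> = (\<lambda>x\<in>X. x)"
  by (simp_all add: BijGroup_def)

lemma Aut_simps:
  "carrier (Aut n X) = {f \<in> Bij X. morphism n X n X f \<and> morphism n X n X (inv_into X f)}"
  "f \<otimes>\<^bsub>Aut n X\<^esub> g = f \<otimes>\<^bsub>BijGroup X\<^esub> g"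
  "\<one>\<^bsub>Aut n X\<^esub> = \<one>\<^bsub>BijGroup X\<^esub>"
  by (simp_all add: Aut_def)

lemma morphism_comp:
  assumes f: "morphism n U m V f" and g: "morphism m V l W g"
  shows "morphism n U l W (\<lambda>x. g (f x))"
  unfolding morphism_def
proof (intro conjI allI impI)
  show "(\<lambda>x. g (f x)) \<in> U \<rightarrow> W" using f g by (auto simp: morphism_def)
  fix i assume i: "i < l"
  obtain p where p: "p \<in> poly_funs m" "\<forall>x\<in>V. g x $ i = p x"
    using g i unfolding morphism_def by blast
  obtain q where q: "q \<in> poly_funs n" "\<forall>x\<in>U. p (f x) = q x"
    using poly_funs_comp[OF p(1), of n U f] f unfolding morphism_def by blast
  have "g (f x) $ i = q x" if "x \<in> U" for x
    using p(2) q(2) f that unfolding morphism_def by (metis Pi_mem)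
  then show "\<exists>p\<in>poly_funs n. \<forall>x\<in>U. g (f x) $ i = p x" using q(1) by blast
qed

lemma morphism_cong:
  assumes "\<And>x. x \<in> U \<Longrightarrow> f x = g x"
  shows "morphism n U m V f \<longleftrightarrow> morphism n U m V g"
  using assms unfolding morphism_def Pi_def by simp

lemma morphism_id: "morphism n X n X (\<lambda>x. x)"
  unfolding morphism_def by (auto intro: poly_funs.coord)

lemma Bij_inv_into:
  assumes "f \<in> Bij X"
  shows "x \<in> X \<Longrightarrow> inv_into X f x \<in> X" "x \<in> X \<Longrightarrow> f (inv_into X f x) = x"
    "x \<in> X \<Longrightarrow> inv_into X f (f x) = x" "x \<in> X \<Longrightarrow> f x \<in> X"
  using assms by (auto simp: Bij_def bij_betw_def f_inv_into_f inv_into_into)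

lemma Bij_inv_into_eqI:
  assumes "f \<in> Bij X" "y \<in> X" "f y = x"
  shows "inv_into X f x = y"
  using assms Bij_inv_into(3) by metis

lemma Aut_subgroup: "subgroup (carrier (Aut n X)) (BijGroup X)"
proof (rule group.subgroupI[OF group_BijGroup])
  show "carrier (Aut n X) \<subseteq> carrier (BijGroup X)" by (auto simp: Aut_simps BijGroup_simps)
  have "morphism n X n X (\<lambda>x\<in>X. x)" 
    using morphism_id by (subst morphism_cong[of X _ "\<lambda>x. x"]) auto
  moreover have "morphism n X n X (inv_into X (\<lambda>x\<in>X. x))"
    using morphism_id id_Bij Bij_inv_into_eqI[OF id_Bij[of X]]
    by (subst morphism_cong[of X _ "\<lambda>x. x"]) auto
  ultimately show "carrier (Aut n X) \<noteq> {}" using id_Bij[of X] by (auto simp: Aut_simps)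
next
  fix f assume "f \<in> carrier (Aut n X)"
  then have f: "f \<in> Bij X" "morphism n X n X f" "morphism n X n X (inv_into X f)"
    by (auto simp: Aut_simps)
  let ?g = "restrict (inv_into X f) X"
  have g: "?g \<in> Bij X" using f by (simp add: restrict_inv_into_Bij)
  have "morphism n X n X ?g" using f(3) by (subst morphism_cong[of X _ "inv_into X f"]) auto
  moreover have "inv_into X ?g x = f x" if "x \<in> X" for x
    using that by (intro Bij_inv_into_eqI[OF g]) (auto simp: Bij_inv_into[OF f(1)])
  then have "morphism n X n X (inv_into X ?g)" using f(2) by (subst morphism_cong[of X _ f]) auto
  ultimately show "inv\<^bsub>BijGroup X\<^esub> f \<in> carrier (Aut n X)" using g f(1) by (simp add: Aut_simps inv_BijGroup)
next
  fix f g assume "f \<in> carrier (Aut n X)" "g \<in> carrier (Aut n X)"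
  then have f: "f \<in> Bij X" "morphism n X n X f" "morphism n X n X (inv_into X f)"
    and g: "g \<in> Bij X" "morphism n X n X g" "morphism n X n X (inv_into X g)"
    by (auto simp: Aut_simps)
  have b: "compose X f g \<in> Bij X" using f g by (simp add: compose_Bij)
  have "morphism n X n X (compose X f g)"
    using morphism_comp[OF g(2) f(2)] by (subst morphism_cong[of X _ "\<lambda>x. f (g x)"]) (auto simp: compose_def)
  moreover have "inv_into X (compose X f g) x = inv_into X g (inv_into X f x)" if "x \<in> X" for x
    using that by (intro Bij_inv_into_eqI[OF b])
      (auto simp: Bij_inv_into[OF f(1)] Bij_inv_into[OF g(1)] compose_def)
  then have "morphism n X n X (inv_into X (compose X f g))"
    using morphism_comp[OF f(3) g(3)] by (subst morphism_cong[of X _ "\<lambda>x. inv_into X g (inv_into X f x)"]) auto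
  ultimately show "f \<otimes>\<^bsub>BijGroup X\<^esub> g \<in> carrier (Aut n X)"
    using b f g by (simp add: Aut_simps BijGroup_simps)
qed

lemma group_Aut: "group (Aut n X)"
proof -
  have "Aut n X = (BijGroup X)\<lparr>carrier := carrier (Aut n X)\<rparr>" by (simp add: Aut_def)
  then show ?thesis using subgroup.subgroup_is_group[OF Aut_subgroup group_BijGroup] by metis
qed

lemma Aut_apply:
  assumes "f \<in> carrier (Aut n X)" "g \<in> carrier (Aut n X)" "x \<in> X"
  shows "(f \<otimes>\<^bsub>Aut n X\<^esub> g) x = f (g x)"
  using assms by (simp add: Aut_simps BijGroup_simps compose_def)

lemma Aut_eqI:
  assumes "f \<in> carrier (Aut n X)" "g \<in> carrier (Aut n X)" "\<And>x. x \<in> X \<Longrightarrow> f x = g x"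
  shows "f = g"
  using assms by (intro extensionalityI[of _ X]) (auto simp: Aut_simps Bij_def)

section \<open>Conjugates of subtori\<close>

text \<open>
  The same algebraic group acts through the conjugated automorphisms, so the conjugate of a subtorus
  carries the algebraic structure of the original.
\<close>

lemma conj_subtorus:
  assumes T: "subtorus n X T" and g: "g \<in> carrier (Aut n X)" and X: "X \<subseteq> carrier_vec n"
  shows "subtorus n X ((\<lambda>t. g \<otimes>\<^bsub>Aut n X\<^esub> t \<otimes>\<^bsub>Aut n X\<^esub> inv\<^bsub>Aut n X\<^esub> g) ` T)"
proof -
  interpret G: group "Aut n X" by (rule group_Aut)
  obtain m H \<phi> where st: "algebraic_structure n X T m H \<phi>" "\<exists>k. alg_group_iso m H (2 * k) (torus k)"
    using T by (auto simp: subtorus_def subtorus_structure_def)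
  have sT: "subgroup T (Aut n X)" and H: "affine_alg_group m H"
    and \<phi>: "\<phi> \<in> iso H ((Aut n X)\<lparr>carrier := T\<rparr>)" and act: "regular_action m H n X \<phi>"
    using st(1) by (auto simp: algebraic_structure_def)
  interpret H: group H using H by (simp add: affine_alg_group_def)
  define c where "c t = g \<otimes>\<^bsub>Aut n X\<^esub> t \<otimes>\<^bsub>Aut n X\<^esub> inv\<^bsub>Aut n X\<^esub> g" for t
  have TA: "T \<subseteq> carrier (Aut n X)" using sT by (rule subgroup.subset)
  have c_mult: "c (s \<otimes>\<^bsub>Aut n X\<^esub> t) = c s \<otimes>\<^bsub>Aut n X\<^esub> c t"
    if "s \<in> carrier (Aut n X)" "t \<in> carrier (Aut n X)" for s t
  proof -
    have "inv\<^bsub>Aut n X\<^esub> g \<otimes>\<^bsub>Aut n X\<^esub> (g \<otimes>\<^bsub>Aut n X\<^esub> y) = y" if "y \<in> carrier (Aut n X)" for y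
      using that g by (simp add: G.m_assoc[symmetric])
    then show ?thesis using that g by (simp add: c_def G.m_assoc)
  qed
  have c_closed: "c t \<in> carrier (Aut n X)" if "t \<in> carrier (Aut n X)" for t
    using that g by (simp add: c_def)
  have c_hom: "group_hom (Aut n X) (Aut n X) c"
    by (rule group_homI[OF G.is_group G.is_group]) (auto simp: hom_def c_mult c_closed)
  have c_inj: "inj_on c T"
    using TA g by (intro inj_onI) (auto simp: c_def subset_iff)
  have \<phi>_mem: "\<phi> h \<in> T" "\<phi> h \<in> carrier (Aut n X)" if "h \<in> carrier H" for h
    using \<phi> that TA by (auto simp: iso_def hom_def)
  have \<phi>_mult: "\<phi> (h \<otimes>\<^bsub>H\<^esub> h') = \<phi> h \<otimes>\<^bsub>Aut n X\<^esub> \<phi> h'" if "h \<in> carrier H" "h' \<in> carrier H" for h h'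
    using \<phi> that by (auto simp: iso_def hom_def)
  have "subgroup (c ` T) (Aut n X)"
    using group_hom.subgroup_img_is_subgroup[OF c_hom sT] .
  moreover have "(\<lambda>h. c (\<phi> h)) \<in> iso H ((Aut n X)\<lparr>carrier := c ` T\<rparr>)"
  proof -
    have "bij_betw \<phi> (carrier H) T" using \<phi> by (simp add: iso_def)
    then have "bij_betw (c \<circ> \<phi>) (carrier H) (c ` T)"
      using c_inj by (intro bij_betw_trans[of \<phi> _ T]) (auto simp: bij_betw_def)
    then show ?thesis by (auto simp: iso_def hom_def \<phi>_mem \<phi>_mult c_mult comp_def)
  qed
  moreover have "regular_action m H n X (\<lambda>h. c (\<phi> h))"
    unfolding regular_action_def
  proof
    show "group_action H X (\<lambda>h. c (\<phi> h))"
      unfolding group_action_def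
    proof (rule group_homI[OF H.is_group group_BijGroup])
      show "(\<lambda>h. c (\<phi> h)) \<in> hom H (BijGroup X)"
      proof (rule homI)
        show "c (\<phi> h) \<in> carrier (BijGroup X)" if "h \<in> carrier H" for h
          using c_closed[OF \<phi>_mem(2)[OF that]] by (simp add: Aut_simps(1) BijGroup_simps(1))
        show "c (\<phi> (h \<otimes>\<^bsub>H\<^esub> h')) = c (\<phi> h) \<otimes>\<^bsub>BijGroup X\<^esub> c (\<phi> h')"
          if "h \<in> carrier H" "h' \<in> carrier H" for h h'
          using that by (simp add: \<phi>_mult c_mult \<phi>_mem Aut_simps(2)[where n = n, symmetric])
      qed
    qed
    let ?V = "prod_variety (carrier H) X"
    have Hc: "carrier H \<subseteq> carrier_vec m" using H by (auto simp: affine_alg_group_def zariski_closed_def)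
    have split: "vec_first (v @\<^sub>v x) m = v \<and> vec_last (v @\<^sub>v x) n = x"
      if "v \<in> carrier H" "x \<in> X" for v x
      using that Hc X by (auto simp: vec_first_def vec_last_def intro!: eq_vecI)
    have gm: "morphism n X n X g" "morphism n X n X (inv\<^bsub>Aut n X\<^esub> g)"
      using g G.inv_closed[OF g] by (auto simp: Aut_simps(1))
    have m1: "morphism (m + n) ?V (m + n) ?V (\<lambda>z. vec_first z m @\<^sub>v (inv\<^bsub>Aut n X\<^esub> g) (vec_last z n))"
      unfolding morphism_def
    proof (intro conjI allI impI)
      have cl: "(inv\<^bsub>Aut n X\<^esub> g) x \<in> X" if "x \<in> X" for x using gm(2) that by (auto simp: morphism_def)
      show "(\<lambda>z. vec_first z m @\<^sub>v (inv\<^bsub>Aut n X\<^esub> g) (vec_last z n)) \<in> ?V \<rightarrow> ?V"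
      proof
        fix z assume "z \<in> ?V"
        then obtain v x where z: "v \<in> carrier H" "x \<in> X" "z = v @\<^sub>v x" by (auto simp: prod_variety_def)
        then show "vec_first z m @\<^sub>v (inv\<^bsub>Aut n X\<^esub> g) (vec_last z n) \<in> ?V"
          using split[OF z(1,2)] cl[OF z(2)] by (auto simp: prod_variety_def)
      qed
      fix i assume i: "i < m + n"
      show "\<exists>p\<in>poly_funs (m + n). \<forall>z\<in>?V. (vec_first z m @\<^sub>v (inv\<^bsub>Aut n X\<^esub> g) (vec_last z n)) $ i = p z"
      proof (cases "i < m")
        case True
        then show ?thesis
          by (intro bexI[of _ "\<lambda>z. z $ i"]) (auto simp: vec_first_def append_vec_def Let_def intro: poly_funs.coord)
      next
        case False
        then have i': "i - m < n" using i by simp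
        obtain p where p: "p \<in> poly_funs n" "\<forall>x\<in>X. (inv\<^bsub>Aut n X\<^esub> g) x $ (i - m) = p x"
          using gm(2) i' unfolding morphism_def by blast
        have "\<exists>q\<in>poly_funs (m + n). \<forall>z\<in>?V. vec_last z n $ j = q z" if j: "j < n" for j
        proof -
          have "vec_last z n $ j = z $ (m + j)" if "z \<in> ?V" for z
          proof -
            obtain v x where z: "v \<in> carrier H" "x \<in> X" "z = v @\<^sub>v x"
              using \<open>z \<in> ?V\<close> by (auto simp: prod_variety_def)
            then have "dim_vec v = m" "dim_vec x = n" using Hc X by auto
            then show ?thesis using j by (simp add: z(3) vec_last_def)
          qed
          then show ?thesis using j by (intro bexI[of _ "\<lambda>z. z $ (m + j)"]) (auto intro: poly_funs.coord)
        qed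
        from poly_funs_comp[OF p(1) this]
        obtain q where q: "q \<in> poly_funs (m + n)" "\<forall>z\<in>?V. p (vec_last z n) = q z" by blast
        have "(vec_first z m @\<^sub>v (inv\<^bsub>Aut n X\<^esub> g) (vec_last z n)) $ i = q z" if "z \<in> ?V" for z
        proof -
          obtain v x where z: "v \<in> carrier H" "x \<in> X" "z = v @\<^sub>v x" using \<open>z \<in> ?V\<close> by (auto simp: prod_variety_def)
          have x: "vec_last z n = x" using split z by blast
          have "dim_vec ((inv\<^bsub>Aut n X\<^esub> g) x) = n" using cl[OF z(2)] X by auto
          then have "(vec_first z m @\<^sub>v (inv\<^bsub>Aut n X\<^esub> g) x) $ i = (inv\<^bsub>Aut n X\<^esub> g) x $ (i - m)"
            using i False by (subst index_append_vec) auto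
          then show ?thesis using p(2) q(2) z(2) \<open>z \<in> ?V\<close> x by auto
        qed
        then show ?thesis using q(1) by blast
      qed
    qed
    have m2: "morphism (m + n) ?V n X (\<lambda>z. \<phi> (vec_first z m) (vec_last z n))"
      using act by (simp add: regular_action_def)
    have "morphism (m + n) ?V n X (\<lambda>z. g (\<phi> (vec_first (vec_first z m @\<^sub>v (inv\<^bsub>Aut n X\<^esub> g) (vec_last z n)) m)
        (vec_last (vec_first z m @\<^sub>v (inv\<^bsub>Aut n X\<^esub> g) (vec_last z n)) n)))"
      by (rule morphism_comp[OF morphism_comp[OF m1 m2] gm(1)])
    moreover have "c (\<phi> (vec_first z m)) (vec_last z n) =
        g (\<phi> (vec_first (vec_first z m @\<^sub>v (inv\<^bsub>Aut n X\<^esub> g) (vec_last z n)) m)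
        (vec_last (vec_first z m @\<^sub>v (inv\<^bsub>Aut n X\<^esub> g) (vec_last z n)) n))" if "z \<in> ?V" for z
    proof -
      obtain v x where z: "v \<in> carrier H" "x \<in> X" "z = v @\<^sub>v x" using \<open>z \<in> ?V\<close> by (auto simp: prod_variety_def)
      have ix: "(inv\<^bsub>Aut n X\<^esub> g) x \<in> X" using gm(2) z(2) by (auto simp: morphism_def)
      have "c (\<phi> v) x = g (\<phi> v ((inv\<^bsub>Aut n X\<^esub> g) x))"
        using g \<phi>_mem(2)[OF z(1)] z(2) ix by (simp add: c_def Aut_apply)
      then show ?thesis using split[OF z(1,2)] split[OF z(1) ix] z(3) by simp
    qed
    ultimately show "morphism (m + n) ?V n X (\<lambda>z. c (\<phi> (vec_first z m)) (vec_last z n))"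
      by (subst morphism_cong) 
  qed
  ultimately have "algebraic_structure n X (c ` T) m H (\<lambda>h. c (\<phi> h))"
    using H by (simp add: algebraic_structure_def)
  then show ?thesis
    using st(2) unfolding subtorus_def subtorus_structure_def c_def by blast
qed

text \<open>
  Transport of the action along an isomorphism onto a standard torus.
\<close>

lemma subtorus_torus_action:
  fixes X :: "'k::{alg_closed_field, field_char_0} vec set"
  assumes st: "algebraic_structure n X T m H \<phi>" and iso: "alg_group_iso m H (2 * k) (torus k)"
    and X: "X \<subseteq> carrier_vec n"
  obtains \<tau> where "torus_action k n X \<tau>" "\<tau> ` torus_pts k = T"
proof -
  have sT: "subgroup T (Aut n X)" and H: "affine_alg_group m H"
    and \<phi>: "\<phi> \<in> iso H ((Aut n X)\<lparr>carrier := T\<rparr>)" and act: "regular_action m H n X \<phi>"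
    using st by (auto simp: algebraic_structure_def)
  interpret H: group H using H by (simp add: affine_alg_group_def)
  have TA: "T \<subseteq> carrier (Aut n X)" using sT by (rule subgroup.subset)
  obtain \<psi> where \<psi>: "\<psi> \<in> iso H (torus k)"
    and inv: "morphism (2 * k) (torus_pts k) m (carrier H) (inv_into (carrier H) \<psi>)"
    using iso by (auto simp: alg_group_iso_def)
  define \<sigma> where "\<sigma> = inv_into (carrier H) \<psi>"
  have \<sigma>: "\<sigma> \<in> iso (torus k) H" unfolding \<sigma>_def by (rule H.iso_set_sym[OF \<psi>])
  have \<sigma>_mem: "\<sigma> v \<in> carrier H" if "v \<in> torus_pts k" for v
    using \<sigma> that by (auto simp: iso_def hom_def)
  have \<phi>_mem: "\<phi> h \<in> T" if "h \<in> carrier H" for h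
    using \<phi> that by (auto simp: iso_def hom_def)
  have Bij: "T \<subseteq> Bij X" using TA by (auto simp: Aut_simps)
  have Hc: "carrier H \<subseteq> carrier_vec m" using H by (auto simp: affine_alg_group_def zariski_closed_def)
  have bb: "bij_betw (\<phi> \<circ> \<sigma>) (torus_pts k) T"
    using \<sigma> \<phi> by (intro bij_betw_trans[of \<sigma> _ "carrier H"]) (auto simp: iso_def)
  have "torus_action k n X (\<lambda>v. \<phi> (\<sigma> v))"
  proof
    show "X \<subseteq> carrier_vec n" by (rule X)
    show "\<phi> (\<sigma> v) \<in> Bij X" if "v \<in> torus_pts k" for v
      using \<phi>_mem \<sigma>_mem that Bij by blast
    show "inj_on (\<lambda>v. \<phi> (\<sigma> v)) (torus_pts k)" using bb by (simp add: bij_betw_def comp_def)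
    show "\<phi> (\<sigma> (v \<otimes>\<^bsub>torus k\<^esub> w)) x = \<phi> (\<sigma> v) (\<phi> (\<sigma> w) x)"
      if "v \<in> torus_pts k" "w \<in> torus_pts k" "x \<in> X" for v w x
    proof -
      have "\<phi> (\<sigma> (v \<otimes>\<^bsub>torus k\<^esub> w)) = \<phi> (\<sigma> v) \<otimes>\<^bsub>Aut n X\<^esub> \<phi> (\<sigma> w)"
        using \<sigma> \<phi> that \<sigma>_mem by (simp add: iso_def hom_def)
      then show ?thesis using that \<sigma>_mem \<phi>_mem TA by (simp add: Aut_apply subset_iff)
    qed
    fix i assume i: "i < n"
    obtain p where p: "p \<in> poly_funs (m + n)"
      "\<forall>z\<in>prod_variety (carrier H) X. \<phi> (vec_first z m) (vec_last z n) $ i = p z"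
      using act i by (auto simp: regular_action_def morphism_def)
    define V where "V = {v @\<^sub>v x | v x. v \<in> torus_pts k \<and> x \<in> X}"
    define s where "s z = \<sigma> (vec_first z (2 * k)) @\<^sub>v vec_last z n" for z :: "'k vec"
    have split: "vec_first (v @\<^sub>v x) (2 * k) = v \<and> vec_last (v @\<^sub>v x) n = x"
      if "v \<in> torus_pts k" "x \<in> X" for v x :: "'k vec"
      using that X by (auto simp: vec_first_def vec_last_def torus_pts_iff intro!: eq_vecI)
    have split': "vec_first (h @\<^sub>v x) m = h \<and> vec_last (h @\<^sub>v x) n = x"
      if "h \<in> carrier H" "x \<in> X" for h x :: "'k vec"
      using that Hc X by (auto simp: vec_first_def vec_last_def intro!: eq_vecI)
    have "\<exists>q\<in>poly_funs (2 * k + n). \<forall>z\<in>V. s z $ j = q z" if j: "j < m + n" for j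
    proof (cases "j < m")
      case True
      obtain q where q: "q \<in> poly_funs (2 * k)" "\<forall>v\<in>torus_pts k. \<sigma> v $ j = q v"
        using inv True unfolding morphism_def \<sigma>_def by blast
      have "\<exists>r\<in>poly_funs (2 * k + n). \<forall>z\<in>V. vec_first z (2 * k) $ l = r z" if l: "l < 2 * k" for l
        using l by (intro bexI[of _ "\<lambda>z. z $ l"]) (auto simp: vec_first_def intro: poly_funs.coord)
      from poly_funs_comp[OF q(1) this] obtain r where
        r: "r \<in> poly_funs (2 * k + n)" "\<forall>z\<in>V. q (vec_first z (2 * k)) = r z" by blast
      have "s z $ j = r z" if "z \<in> V" for z
      proof -
        obtain v x where z: "v \<in> torus_pts k" "x \<in> X" "z = v @\<^sub>v x" using \<open>z \<in> V\<close> by (auto simp: V_def)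
        have "dim_vec (\<sigma> v) = m" using \<sigma>_mem[OF z(1)] Hc by auto
        then have "s z $ j = \<sigma> v $ j" using True split[OF z(1,2)] z(3) by (simp add: s_def)
        also have "\<dots> = q v" using q(2) z(1) by blast
        also have "\<dots> = r z" using r(2) \<open>z \<in> V\<close> split[OF z(1,2)] z(3) by metis
        finally show ?thesis .
      qed
      then show ?thesis using r(1) by blast
    next
      case False
      then obtain l where l: "j = m + l" by (metis le_iff_add not_le)
      have "s z $ j = z $ (2 * k + l)" if "z \<in> V" for z
      proof -
        obtain v x where z: "v \<in> torus_pts k" "x \<in> X" "z = v @\<^sub>v x" using \<open>z \<in> V\<close> by (auto simp: V_def)
        have d: "dim_vec (\<sigma> v) = m" "dim_vec x = n" "dim_vec v = 2 * k"
          using \<sigma>_mem[OF z(1)] Hc z(1,2) X by (auto simp: torus_pts_iff)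
        then have "s z $ j = x $ l" using l split[OF z(1,2)] z(3) j by (simp add: s_def)
        then show ?thesis using d l j by (simp add: z(3))
      qed
      then show ?thesis using j l
        by (intro bexI[of _ "\<lambda>z. z $ (2 * k + l)"]) (auto intro: poly_funs.coord)
    qed
    from poly_funs_comp[OF p(1) this] obtain q where
      q: "q \<in> poly_funs (2 * k + n)" "\<forall>z\<in>V. p (s z) = q z" by blast
    have "\<phi> (\<sigma> v) x $ i = q (v @\<^sub>v x)" if v: "v \<in> torus_pts k" and x: "x \<in> X" for v x
    proof -
      have "\<sigma> v @\<^sub>v x \<in> prod_variety (carrier H) X" using \<sigma>_mem[OF v] x by (auto simp: prod_variety_def)
      then have "\<phi> (\<sigma> v) x $ i = p (\<sigma> v @\<^sub>v x)" using p(2) split'[OF \<sigma>_mem[OF v] x] by metis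
      also have "\<dots> = p (s (v @\<^sub>v x))" using split[OF v x] by (simp add: s_def)
      also have "\<dots> = q (v @\<^sub>v x)" using q(2) v x by (auto simp: V_def)
      finally show ?thesis .
    qed
    then show "\<exists>p\<in>poly_funs (2 * k + n). \<forall>v\<in>torus_pts k. \<forall>x\<in>X. \<phi> (\<sigma> v) x $ i = p (v @\<^sub>v x)"
      using q(1) by blast
  qed
  moreover have "(\<lambda>v. \<phi> (\<sigma> v)) ` torus_pts k = T" using bb by (simp add: bij_betw_def comp_def)
  ultimately show ?thesis using that by blast
qed

section \<open>The integral representation\<close>

text \<open>
  The matrix of \<open>g\<close> is characterised by the relation \<open>g \<tau>(v) = \<tau>(v\<^sup>A) g\<close>. Moving two automorphisms past
  \<open>\<tau> v\<close> one after the other shows multiplicativity, and the matrix is the identity exactly if \<open>g\<close>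
  commutes with every \<open>\<tau> v\<close>.
\<close>

lemma normal_torus_representation:
  fixes X :: "'k::{alg_closed_field, field_char_0} vec set"
  assumes act: "torus_action k n X \<tau>" and T: "\<tau> ` torus_pts k = T" and TA: "T \<subseteq> carrier (Aut n X)"
    and conj: "\<And>g t. g \<in> carrier (Aut n X) \<Longrightarrow> t \<in> T \<Longrightarrow>
      g \<otimes>\<^bsub>Aut n X\<^esub> t \<otimes>\<^bsub>Aut n X\<^esub> inv\<^bsub>Aut n X\<^esub> g \<in> T"
  shows "\<exists>M :: ('k vec \<Rightarrow> 'k vec) \<Rightarrow> int mat.
    (\<forall>g\<in>carrier (Aut n X). M g \<in> carrier_mat k k) \<and>
    (\<forall>g\<in>carrier (Aut n X). \<forall>h\<in>carrier (Aut n X). M (g \<otimes>\<^bsub>Aut n X\<^esub> h) = M g * M h) \<and>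
    M \<one>\<^bsub>Aut n X\<^esub> = 1\<^sub>m k \<and>
    (\<forall>g\<in>carrier (Aut n X). M g = 1\<^sub>m k \<longleftrightarrow> g \<in> centralizer (Aut n X) T)"
proof -
  interpret torus_action k n X \<tau> by (rule act)
  interpret G: group "Aut n X" by (rule group_Aut)
  let ?G = "Aut n X"
  have \<tau>: "\<tau> v \<in> carrier ?G" if "v \<in> torus_pts k" for v using T TA that by blast
  define rep where "rep g A \<longleftrightarrow> A \<in> carrier_mat k k \<and>
    (\<forall>v\<in>torus_pts k. g \<otimes>\<^bsub>?G\<^esub> \<tau> v = \<tau> (monomial_map k A v) \<otimes>\<^bsub>?G\<^esub> g)" for g A
  have ex: "\<exists>A. rep g A" if g: "g \<in> carrier ?G" for g
  proof -
    have gB: "g \<in> Bij X" using g by (simp add: Aut_simps)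
    have "g ` X = X" using gB by (simp add: Bij_def bij_betw_def)
    moreover have "\<exists>p\<in>poly_funs n. \<forall>x\<in>X. g x $ i = p x" if "i < n" for i
      using g that by (auto simp: Aut_simps morphism_def)
    moreover have "\<exists>w\<in>torus_pts k. \<forall>x\<in>X. g (\<tau> v x) = \<tau> w (g x)" if v: "v \<in> torus_pts k" for v
    proof -
      have "g \<otimes>\<^bsub>?G\<^esub> \<tau> v \<otimes>\<^bsub>?G\<^esub> inv\<^bsub>?G\<^esub> g \<in> T" using conj[OF g] v T by blast
      then obtain w where w: "w \<in> torus_pts k" "g \<otimes>\<^bsub>?G\<^esub> \<tau> v \<otimes>\<^bsub>?G\<^esub> inv\<^bsub>?G\<^esub> g = \<tau> w"
        using T by force
      have "g \<otimes>\<^bsub>?G\<^esub> \<tau> v = \<tau> w \<otimes>\<^bsub>?G\<^esub> g"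
        using g \<tau>[OF v] by (simp add: w(2)[symmetric] G.m_assoc)
      then have "g (\<tau> v x) = \<tau> w (g x)" if "x \<in> X" for x
        using Aut_apply[OF g \<tau>[OF v] that] Aut_apply[OF \<tau>[OF w(1)] g that] by metis
      then show ?thesis using w(1) by blast
    qed
    ultimately obtain A where A: "A \<in> carrier_mat k k"
      "\<forall>v\<in>torus_pts k. \<forall>x\<in>X. g (\<tau> v x) = \<tau> (monomial_map k A v) (g x)"
      using normalizing_monomial_map[of g] by blast
    have "g \<otimes>\<^bsub>?G\<^esub> \<tau> v = \<tau> (monomial_map k A v) \<otimes>\<^bsub>?G\<^esub> g" if v: "v \<in> torus_pts k" for v
    proof (rule Aut_eqI[of _ n X])
      note w = \<tau>[OF monomial_map_mem[OF v, of A]]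
      show "g \<otimes>\<^bsub>?G\<^esub> \<tau> v \<in> carrier ?G" "\<tau> (monomial_map k A v) \<otimes>\<^bsub>?G\<^esub> g \<in> carrier ?G"
        using g \<tau>[OF v] w by auto
      show "(g \<otimes>\<^bsub>?G\<^esub> \<tau> v) x = (\<tau> (monomial_map k A v) \<otimes>\<^bsub>?G\<^esub> g) x" if "x \<in> X" for x
        using A(2) v that Aut_apply[OF g \<tau>[OF v] that] Aut_apply[OF w g that] by simp
    qed
    then show ?thesis using A(1) by (auto simp: rep_def)
  qed
  have uniq: "A = B" if g: "g \<in> carrier ?G" and A: "rep g A" and B: "rep g B" for g A B
  proof (rule monomial_map_inj)
    show "A \<in> carrier_mat k k" "B \<in> carrier_mat k k" using A B by (auto simp: rep_def)
    fix v :: "'k vec" assume v: "v \<in> torus_pts k"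
    note w = monomial_map_mem[OF v]
    have "\<tau> (monomial_map k A v) \<otimes>\<^bsub>?G\<^esub> g = \<tau> (monomial_map k B v) \<otimes>\<^bsub>?G\<^esub> g"
      using A B v by (simp add: rep_def)
    then have "\<tau> (monomial_map k A v) = \<tau> (monomial_map k B v)"
      using g \<tau>[OF w] by simp
    then show "monomial_map k A v = monomial_map k B v"
      using faithful w by (auto simp: inj_on_def)
  qed
  define M where "M g = (THE A. rep g A)" for g
  have M: "rep g (M g)" if g: "g \<in> carrier ?G" for g
    unfolding M_def using ex[OF g] uniq[OF g] by (blast intro: theI2)
  have M_eq: "M g = A" if "g \<in> carrier ?G" "rep g A" for g A
    using uniq M that by blast
  have one: "rep g (1\<^sub>m k) \<longleftrightarrow> g \<in> centralizer ?G T" if g: "g \<in> carrier ?G" for g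
    using g unfolding rep_def centralizer_def T[symmetric] by (auto simp: monomial_map_one)
  show ?thesis
  proof (intro exI[of _ M] conjI ballI)
    show "M g \<in> carrier_mat k k" if "g \<in> carrier ?G" for g using M[OF that] by (simp add: rep_def)
    show "M (g \<otimes>\<^bsub>?G\<^esub> h) = M g * M h" if g: "g \<in> carrier ?G" and h: "h \<in> carrier ?G" for g h
    proof (rule M_eq)
      show "g \<otimes>\<^bsub>?G\<^esub> h \<in> carrier ?G" using g h by simp
      have A: "M g \<in> carrier_mat k k" and B: "M h \<in> carrier_mat k k"
        using M[OF g] M[OF h] by (auto simp: rep_def)
      have "(g \<otimes>\<^bsub>?G\<^esub> h) \<otimes>\<^bsub>?G\<^esub> \<tau> v = \<tau> (monomial_map k (M g * M h) v) \<otimes>\<^bsub>?G\<^esub> (g \<otimes>\<^bsub>?G\<^esub> h)"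
        if v: "v \<in> torus_pts k" for v
      proof -
        let ?w = "monomial_map k (M h) v"
        note w = monomial_map_mem[OF v, of "M h"]
        note u = monomial_map_mem[OF w, of "M g"]
        have "(g \<otimes>\<^bsub>?G\<^esub> h) \<otimes>\<^bsub>?G\<^esub> \<tau> v = g \<otimes>\<^bsub>?G\<^esub> (\<tau> ?w \<otimes>\<^bsub>?G\<^esub> h)"
          using M[OF h] v g h \<tau>[OF v] by (simp add: rep_def G.m_assoc)
        also have "\<dots> = (g \<otimes>\<^bsub>?G\<^esub> \<tau> ?w) \<otimes>\<^bsub>?G\<^esub> h"
          using g h \<tau>[OF w] by (simp add: G.m_assoc)
        also have "\<dots> = (\<tau> (monomial_map k (M g) ?w) \<otimes>\<^bsub>?G\<^esub> g) \<otimes>\<^bsub>?G\<^esub> h"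
          using M[OF g] w by (simp add: rep_def)
        also have "\<dots> = \<tau> (monomial_map k (M g * M h) v) \<otimes>\<^bsub>?G\<^esub> (g \<otimes>\<^bsub>?G\<^esub> h)"
          using monomial_map_mult[OF v A B] g h \<tau>[OF u] by (simp add: G.m_assoc)
        finally show ?thesis .
      qed
      then show "rep (g \<otimes>\<^bsub>?G\<^esub> h) (M g * M h)" using A B by (simp add: rep_def)
    qed
    show "M \<one>\<^bsub>?G\<^esub> = 1\<^sub>m k"
      by (rule M_eq) (use \<tau> in \<open>auto simp: rep_def monomial_map_one\<close>)
    show "M g = 1\<^sub>m k \<longleftrightarrow> g \<in> centralizer ?G T" if g: "g \<in> carrier ?G" for g
      using M[OF g] M_eq[OF g] one[OF g] by metis
  qed
qed

lemma GL_int_group: "group (GL_int r)"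
  unfolding GL_int_def
  by (intro monoid.units_group ring.axioms ring_mat abelian_group.axioms semiring.axioms)

definition pad_identity :: "nat \<Rightarrow> nat \<Rightarrow> int mat \<Rightarrow> int mat" where
  "pad_identity k l A = four_block_mat A (0\<^sub>m k l) (0\<^sub>m l k) (1\<^sub>m l)"

lemma pad_identity_one: "pad_identity k l (1\<^sub>m k) = 1\<^sub>m (k + l)"
  unfolding pad_identity_def by (rule eq_matI) auto

lemma pad_identity_closed: "A \<in> carrier_mat k k \<Longrightarrow> pad_identity k l A \<in> carrier_mat (k + l) (k + l)"
  unfolding pad_identity_def by auto

lemma pad_identity_mult:
  assumes "A \<in> carrier_mat k k" "B \<in> carrier_mat k k"
  shows "pad_identity k l A * pad_identity k l B = pad_identity k l (A * B)"
  unfolding pad_identity_def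
  using assms by (subst mult_four_block_mat[of _ k k _ l _ l _ _ k _ l]) auto

lemma pad_identity_inj:
  assumes A: "A \<in> carrier_mat k k" and B: "B \<in> carrier_mat k k"
    and eq: "pad_identity k l A = pad_identity k l B"
  shows "A = B"
proof (rule eq_matI)
  fix i j assume "i < dim_row B" "j < dim_col B"
  then have ij: "i < k" "j < k" using B by auto
  have "pad_identity k l A $$ (i, j) = A $$ (i, j)" "pad_identity k l B $$ (i, j) = B $$ (i, j)"
    unfolding pad_identity_def using A B ij by auto
  then show "A $$ (i, j) = B $$ (i, j)" using eq by simp
qed (use A B in auto)

theorem mainTheorem2:
  fixes n r :: nat
    and X :: "'k::{alg_closed_field, field_char_0} vec set"
    and T :: "('k vec \<Rightarrow> 'k vec) set"
  assumes "irreducible_closed n X"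
    and "rigid n X"
    and "maximal_torus n X T"
    and "subtorus_has_dim n X T r"
  shows "centralizer (Aut n X) T \<lhd> Aut n X \<and>
    (\<exists>S. subgroup S (GL_int r) \<and>
      (Aut n X Mod centralizer (Aut n X) T) \<cong> (GL_int r)\<lparr>carrier := S\<rparr>)"
proof -
  let ?G = "Aut n X"
  have X: "X \<subseteq> carrier_vec n"
    using assms(1) by (auto simp: irreducible_closed_def zariski_closed_def)
  obtain m H \<phi> k where st: "algebraic_structure n X T m H \<phi>"
    and iso: "alg_group_iso m H (2 * k) (torus k)" and dim: "variety_dim m (carrier H) = enat r"
    using assms(4) by (auto simp: subtorus_has_dim_def subtorus_structure_def)
  have H: "affine_alg_group m H" and TA: "T \<subseteq> carrier ?G"
    using st by (auto simp: algebraic_structure_def dest: subgroup.subset)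
  have kr: "k \<le> r" using torus_dim_ge[OF H iso] dim by simp
  obtain \<tau> where \<tau>: "torus_action k n X \<tau>" "\<tau> ` torus_pts k = T"
    using subtorus_torus_action[OF st iso X] by blast
  have conj: "g \<otimes>\<^bsub>?G\<^esub> t \<otimes>\<^bsub>?G\<^esub> inv\<^bsub>?G\<^esub> g \<in> T" if "g \<in> carrier ?G" "t \<in> T" for g t
    using assms(3) conj_subtorus[OF _ that(1) X, of T] that(2) unfolding maximal_torus_def by blast
  obtain M :: "('k vec \<Rightarrow> 'k vec) \<Rightarrow> int mat" where M': "\<forall>g\<in>carrier ?G. M g \<in> carrier_mat k k"
    "\<forall>g\<in>carrier ?G. \<forall>h\<in>carrier ?G. M (g \<otimes>\<^bsub>?G\<^esub> h) = M g * M h"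
    "M \<one>\<^bsub>?G\<^esub> = 1\<^sub>m k"
    "\<forall>g\<in>carrier ?G. M g = 1\<^sub>m k \<longleftrightarrow> g \<in> centralizer ?G T"
    using normal_torus_representation[OF \<tau> TA conj] by blast
  note M = M'(1)[rule_format] M'(2)[rule_format] M'(3) M'(4)[rule_format]
  define d where "d = pad_identity k (r - k)"
  have kl: "k + (r - k) = r" using kr by simp
  interpret G: group ?G by (rule group_Aut)
  interpret GL: group "GL_int r" by (rule GL_int_group)
  have GL: "carrier (GL_int r) = {A \<in> carrier_mat r r. \<exists>B\<in>carrier_mat r r. B * A = 1\<^sub>m r \<and> A * B = 1\<^sub>m r}"
    "\<one>\<^bsub>GL_int r\<^esub> = 1\<^sub>m r" "A \<otimes>\<^bsub>GL_int r\<^esub> B = A * B" for A B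
    by (auto simp: GL_int_def units_of_def Units_def ring_mat_simps)
  have one: "d (1\<^sub>m k) = 1\<^sub>m r" using pad_identity_one[of k "r - k"] kl by (simp add: d_def)
  have mult: "d (M (g \<otimes>\<^bsub>?G\<^esub> h)) = d (M g) * d (M h)" if "g \<in> carrier ?G" "h \<in> carrier ?G" for g h
    using pad_identity_mult[OF M(1) M(1)] M(2) that by (simp add: d_def)
  have mem: "d (M g) \<in> carrier_mat r r" if "g \<in> carrier ?G" for g
    using pad_identity_closed[OF M(1)[OF that], of "r - k"] kl by (simp add: d_def)
  have GLmem: "d (M g) \<in> carrier (GL_int r)" if g: "g \<in> carrier ?G" for g
  proof -
    note g' = G.inv_closed[OF g]
    have "d (M g) * d (M (inv\<^bsub>?G\<^esub> g)) = 1\<^sub>m r"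
      unfolding mult[OF g g', symmetric] G.r_inv[OF g] M(3) one ..
    moreover have "d (M (inv\<^bsub>?G\<^esub> g)) * d (M g) = 1\<^sub>m r"
      unfolding mult[OF g' g, symmetric] G.l_inv[OF g] M(3) one ..
    ultimately show ?thesis unfolding GL(1) using mem[OF g] mem[OF g'] by blast
  qed
  interpret \<rho>: group_hom ?G "GL_int r" "\<lambda>g. d (M g)"
    by (rule group_homI[OF G.is_group GL.is_group]) (auto simp: hom_def GLmem mult GL(3))
  have ker: "kernel ?G (GL_int r) (\<lambda>g. d (M g)) = centralizer ?G T"
  proof -
    have "d (M g) = 1\<^sub>m r \<longleftrightarrow> M g = 1\<^sub>m k" if "g \<in> carrier ?G" for g
      using pad_identity_inj[OF M(1)[OF that] one_carrier_mat, of "r - k"] one by (auto simp: d_def)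
    then show ?thesis using M(4) by (auto simp: kernel_def GL(2) centralizer_def)
  qed
  let ?S = "(\<lambda>g. d (M g)) ` carrier ?G"
  have S: "subgroup ?S (GL_int r)" by (rule \<rho>.img_is_subgroup)
  interpret \<rho>': group_hom ?G "(GL_int r)\<lparr>carrier := ?S\<rparr>" "\<lambda>g. d (M g)"
    by (rule group_homI[OF G.is_group subgroup.subgroup_is_group[OF S GL.is_group]])
      (auto simp: hom_def mult GL(3))
  have "kernel ?G ((GL_int r)\<lparr>carrier := ?S\<rparr>) (\<lambda>g. d (M g)) = centralizer ?G T"
    using ker by (simp add: kernel_def)
  then have "(?G Mod centralizer ?G T) \<cong> (GL_int r)\<lparr>carrier := ?S\<rparr>"
    using \<rho>'.FactGroup_iso by simp
  moreover have "centralizer ?G T \<lhd> ?G" using \<rho>.normal_kernel ker by simp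
  ultimately show ?thesis using S by blast
qed

end
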